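(* Let $\varepsilon>0$, and suppose that $G$ is a finite group satisfying $\mathfrak{D}(G)\ge\log^2(|G|)$. Let $S\subseteq G$ be a symmetric subset and $\mathcal{G}=\mathrm{Cay}(G,S)$. Then, given $M\in\mathbb{N}$ satisfying $$M\le\min\left(\tfrac{1}{24}|G|^{\varepsilon},\ \tfrac18|G|^{-1}e^{\frac{\mathfrak{D}(G)}{12}}\right)$$ and functions $f_i:G\to\mathbb{R}$ for $i=1,\dots,M$, there exists an orthonormal basis $\mathcal{B}$ of $\ell^2(G)$ consisting of real-valued eigenfunctions of (the adjacency operator of) $\mathcal{G}$ such that for every $\varphi\in\mathcal{B}$ and $i=1,\dots,M$, $$\left|\mu_\varphi[f_i]-\frac{\sum_{g\in G}f_i(g)}{|G|}\right|\le 64\,\frac{(\varepsilon+1)\log(|G|)}{\sqrt{\mathfrak{D}(G)}}\,\frac{\|f_i\|_{\ell^2}}{\sqrt{|G|}}.$$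
   Context: For a (nontrivial) finite group $G$, $\mathfrak{D}(G)$ denotes the smallest dimension of a non-trivial irreducible complex representation of $G$; $\log^2(x)=(\log x)^2$. $\ell^2(G)$ is the space of complex-valued functions on $G$ with inner product $\langle f_1,f_2\rangle=\sum_{g\in G}f_1(g)\overline{f_2(g)}$ (counting measure) and associated norm $\|\cdot\|_{\ell^2}$. A subset $S$ is symmetric if $S=S^{-1}$. $\mathrm{Cay}(G,S)$ is the Cayley graph with vertex set $G$ and edges joining $g$ to $gs$ for $s\in S$; its adjacency operator on $\ell^2(G)$ is $\mathcal{A}[f](g)=\sum_{s\in S}f(gs)$. For $\varphi\in\ell^2(G)$ with $\|\varphi\|_{\ell^2}=1$, $\mu_\varphi[f]=\sum_{g\in G}f(g)|\varphi(g)|^2$. *)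

theory Defs
  imports Complex_Main "Jordan_Normal_Form.VS_Connect"
begin

text \<open>Complex representations of dimension \<open>n\<close>, as homomorphisms into \<open>GL(n, \<complex>)\<close>.\<close>

definition representation :: "('a, 'b) monoid_scheme \<Rightarrow> nat \<Rightarrow> ('a \<Rightarrow> complex mat) \<Rightarrow> bool" where
  "representation G n \<rho> \<longleftrightarrow> \<rho> \<in> hom G (units_of (ring_mat TYPE(complex) n ()))"

definition irreducible_rep :: "('a, 'b) monoid_scheme \<Rightarrow> nat \<Rightarrow> ('a \<Rightarrow> complex mat) \<Rightarrow> bool" where
  "irreducible_rep G n \<rho> \<longleftrightarrow> representation G n \<rho> \<and> n > 0 \<and>
     (\<forall>W. VectorSpace.subspace class_ring W (module_vec TYPE(complex) n) \<and>
          (\<forall>g\<in>carrier G. \<forall>w\<in>W. \<rho> g *\<^sub>v w \<in> W) \<longrightarrow>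
          W = {0\<^sub>v n} \<or> W = carrier_vec n)"

definition trivial_rep :: "('a, 'b) monoid_scheme \<Rightarrow> nat \<Rightarrow> ('a \<Rightarrow> complex mat) \<Rightarrow> bool" where
  "trivial_rep G n \<rho> \<longleftrightarrow> n = 1 \<and> (\<forall>g\<in>carrier G. \<rho> g = 1\<^sub>m n)"

text \<open>A nontrivial finite group has a nontrivial irreducible representation, so the minimum exists;
  for the one-element group the value is unspecified.\<close>

definition min_rep_dim :: "('a, 'b) monoid_scheme \<Rightarrow> nat" where
  "min_rep_dim G = (LEAST n. \<exists>\<rho>. irreducible_rep G n \<rho> \<and> \<not> trivial_rep G n \<rho>)"

text \<open>Elements of \<open>\<ell>\<^sup>2(G)\<close> are functions on the whole type that vanish outside the carrier, so that equality
  of functions on the type is equality on \<open>G\<close>.\<close>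

definition ell2 :: "('a, 'b) monoid_scheme \<Rightarrow> ('a \<Rightarrow> complex) set" where
  "ell2 G = {f. \<forall>g. g \<notin> carrier G \<longrightarrow> f g = 0}"

definition ell2_inner :: "('a, 'b) monoid_scheme \<Rightarrow> ('a \<Rightarrow> complex) \<Rightarrow> ('a \<Rightarrow> complex) \<Rightarrow> complex" where
  "ell2_inner G f h = (\<Sum>g\<in>carrier G. f g * cnj (h g))"

definition ell2_norm :: "('a, 'b) monoid_scheme \<Rightarrow> ('a \<Rightarrow> complex) \<Rightarrow> real" where
  "ell2_norm G f = sqrt (Re (ell2_inner G f f))"

definition orthonormal_basis_ell2 :: "('a, 'b) monoid_scheme \<Rightarrow> ('a \<Rightarrow> complex) set \<Rightarrow> bool" where
  "orthonormal_basis_ell2 G B \<longleftrightarrow> finite B \<and> B \<subseteq> ell2 G \<and>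
     (\<forall>\<phi>\<in>B. \<forall>\<psi>\<in>B. ell2_inner G \<phi> \<psi> = (if \<phi> = \<psi> then 1 else 0)) \<and>
     (\<forall>f\<in>ell2 G. \<exists>c. \<forall>g. f g = (\<Sum>\<phi>\<in>B. c \<phi> * \<phi> g))"

text \<open>The adjacency operator of the Cayley graph with vertex set \<open>G\<close> and edges joining \<open>g\<close> to \<open>g \<otimes> s\<close> for \<open>s \<in> S\<close>.\<close>

definition cayley_adjacency ::
    "('a, 'b) monoid_scheme \<Rightarrow> 'a set \<Rightarrow> ('a \<Rightarrow> complex) \<Rightarrow> 'a \<Rightarrow> complex" where
  "cayley_adjacency G S f g = (if g \<in> carrier G then \<Sum>s\<in>S. f (g \<otimes>\<^bsub>G\<^esub> s) else 0)"

definition cayley_eigenfunction :: "('a, 'b) monoid_scheme \<Rightarrow> 'a set \<Rightarrow> ('a \<Rightarrow> complex) \<Rightarrow> bool" where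
  "cayley_eigenfunction G S \<phi> \<longleftrightarrow> \<phi> \<in> ell2 G \<and> \<phi> \<noteq> (\<lambda>_. 0) \<and>
     (\<exists>c. \<forall>g. cayley_adjacency G S \<phi> g = c * \<phi> g)"

definition eigen_measure ::
    "('a, 'b) monoid_scheme \<Rightarrow> ('a \<Rightarrow> complex) \<Rightarrow> ('a \<Rightarrow> real) \<Rightarrow> real" where
  "eigen_measure G \<phi> f = (\<Sum>g\<in>carrier G. f g * (cmod (\<phi> g))\<^sup>2)"

end

theory Submission
  imports Defs "HOL-Analysis.Function_Topology" "HOL-Analysis.Convex"
begin

text \<open>
  The eigenspaces of the adjacency operator are invariant under left translations, and left
  invariance makes \<open>\<Sum>\<^sub>k (e\<^sub>k g)\<^sup>2\<close> independent of \<open>g\<close> for an orthonormal basis \<open>e\<close> of an eigenspace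
  \<open>E\<close> of dimension \<open>n\<close>. Hence for \<open>h\<close> of mean zero the compression to \<open>E\<close> of multiplication by \<open>h\<close> has
  trace zero and squared Hilbert-Schmidt norm at most \<open>n \<parallel>h\<parallel>\<^sup>2 / |G|\<close>. Moreover \<open>n\<close> is at least the minimal
  dimension of a nontrivial representation as soon as \<open>E\<close> is orthogonal to the constants.

  Instead of a random orthonormal basis of \<open>E\<close>, take one that minimises a smooth potential. If
  \<open>q\<close> runs through the normalised compressions, \<open>u\<close> is a multiple of \<open>\<langle>q v, v\<rangle>\<close> and \<open>w\<close> of \<open>\<parallel>q v\<parallel>\<^sup>2\<close>, the
  potential is the sum of \<open>cosh u + exp w\<close> over all \<open>q\<close> and all basis vectors \<open>v\<close>. Its second
  variation under rotations in the planes spanned by two basis vectors is nonnegative; adding up these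
  inequalities bounds the sum of \<open>|u| exp |u|\<close> by a multiple of the number of terms, so that every single
  \<open>|u|\<close> is at most logarithmic. The same minimisation with the potential
  \<open>- \<langle>T v, v\<rangle>\<^sup>2\<close> diagonalises a symmetric matrix \<open>T\<close>.
\<close>

section \<open>Orthogonal matrices minimising a potential\<close>

text \<open>Rows and columns are both required to be orthonormal, so transposing stays inside the
  set without a dimension count. Entries off \<open>I\<close> are fixed at 0, which makes the set of
  these matrices compact as a set of functions on the whole type.\<close>

definition orth :: "'i set \<Rightarrow> ('i \<Rightarrow> 'i \<Rightarrow> real) \<Rightarrow> bool" where
  "orth I U \<longleftrightarrow>
     (\<forall>j\<in>I. \<forall>k\<in>I. (\<Sum>l\<in>I. U j l * U k l) = (if j = k then 1 else 0)) \<and>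
     (\<forall>j\<in>I. \<forall>k\<in>I. (\<Sum>l\<in>I. U l j * U l k) = (if j = k then 1 else 0)) \<and>
     (\<forall>j k. j \<notin> I \<or> k \<notin> I \<longrightarrow> U j k = 0)"

definition bil :: "'i set \<Rightarrow> ('i \<Rightarrow> 'i \<Rightarrow> real) \<Rightarrow> ('i \<Rightarrow> real) \<Rightarrow> ('i \<Rightarrow> real) \<Rightarrow> real" where
  "bil I p x y = (\<Sum>a\<in>I. \<Sum>b\<in>I. x a * p a b * y b)"

lemma orth_row:
  "orth I U \<Longrightarrow> j \<in> I \<Longrightarrow> k \<in> I \<Longrightarrow> (\<Sum>l\<in>I. U j l * U k l) = (if j = k then 1 else 0)"
  by (simp add: orth_def)

lemma orth_col:
  "orth I U \<Longrightarrow> j \<in> I \<Longrightarrow> k \<in> I \<Longrightarrow> (\<Sum>l\<in>I. U l j * U l k) = (if j = k then 1 else 0)"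
  by (simp add: orth_def)

lemma orth_outside: "orth I U \<Longrightarrow> j \<notin> I \<or> k \<notin> I \<Longrightarrow> U j k = 0"
  unfolding orth_def by blast

lemma orth_abs_le:
  assumes "finite I" "orth I U"
  shows "\<bar>U j k\<bar> \<le> 1"
proof (cases "j \<in> I \<and> k \<in> I")
  case True
  have "(U j k)\<^sup>2 \<le> (\<Sum>l\<in>I. (U j l)\<^sup>2)"
    using True assms(1) by (intro member_le_sum) auto
  also have "\<dots> = 1"
    using orth_row[OF assms(2), of j j] True by (simp add: power2_eq_square)
  finally show ?thesis
    by (simp add: abs_square_le_1)
qed (use orth_outside[OF assms(2)] in auto)

lemma orth_id:
  assumes "finite I"
  shows "orth I (\<lambda>j k. if j = k \<and> j \<in> I then 1 else 0)"
proof -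
  define D :: "'a \<Rightarrow> 'a \<Rightarrow> real" where "D j k = (if j = k \<and> j \<in> I then 1 else 0)" for j k
  have row: "(\<Sum>l\<in>I. D j l * D k l) = (if j = k then 1 else 0)" if "j \<in> I" for j k
  proof -
    have "(\<Sum>l\<in>I. D j l * D k l) = (\<Sum>l\<in>I. if j = l then if k = j then 1 else 0 else 0)"
      using that by (intro sum.cong) (auto simp: D_def)
    then show ?thesis using assms that by simp
  qed
  moreover have "(\<Sum>l\<in>I. D l j * D l k) = (\<Sum>l\<in>I. D j l * D k l)" for j k
    by (intro sum.cong) (auto simp: D_def)
  moreover have "j \<notin> I \<or> k \<notin> I \<longrightarrow> D j k = 0" for j k
    by (auto simp: D_def)
  ultimately have "orth I D" by (simp add: orth_def)
  then show ?thesis unfolding D_def .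
qed

lemma bil_add_left: "bil I p (\<lambda>a. c * x a + d * y a) z = c * bil I p x z + d * bil I p y z"
  by (simp add: bil_def sum_distrib_left sum.distrib algebra_simps)

lemma bil_add_right: "bil I p z (\<lambda>a. c * x a + d * y a) = c * bil I p z x + d * bil I p z y"
  by (simp add: bil_def sum_distrib_left sum.distrib algebra_simps)

lemma bil_commute:
  assumes "\<And>a b. a \<in> I \<Longrightarrow> b \<in> I \<Longrightarrow> p a b = p b a"
  shows "bil I p x y = bil I p y x"
proof -
  have "bil I p x y = (\<Sum>b\<in>I. \<Sum>a\<in>I. x a * p a b * y b)"
    unfolding bil_def by (rule sum.swap)
  also have "\<dots> = bil I p y x"
    unfolding bil_def by (intro sum.cong refl) (simp add: assms)
  finally show ?thesis .
qed

lemma bil_alt: "bil I p x y = (\<Sum>a\<in>I. x a * (\<Sum>b\<in>I. p a b * y b))"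
  by (simp add: bil_def sum_distrib_left mult.assoc)

text \<open>Left multiplication by a Givens rotation: the rows of \<open>U\<close> are the basis
  vectors, and two of them turn in the plane they span.\<close>

definition rot :: "'i \<Rightarrow> 'i \<Rightarrow> real \<Rightarrow> ('i \<Rightarrow> 'i \<Rightarrow> real) \<Rightarrow> 'i \<Rightarrow> 'i \<Rightarrow> real" where
  "rot j k \<theta> U = U(j := \<lambda>l. cos \<theta> * U j l + sin \<theta> * U k l,
                     k := \<lambda>l. (- sin \<theta>) * U j l + cos \<theta> * U k l)"

lemma sum_split2:
  fixes h :: "'i \<Rightarrow> real"
  assumes "finite I" "j \<in> I" "k \<in> I" "j \<noteq> k"
  shows "sum h I = h j + h k + sum h (I - {j, k})"
proof -
  have "sum h I = h j + sum h (I - {j})" using assms by (simp add: sum.remove)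
  also have "sum h (I - {j}) = h k + sum h (I - {j} - {k})" using assms by (simp add: sum.remove)
  also have "I - {j} - {k} = I - {j, k}" by auto
  finally show ?thesis by simp
qed

lemma orth_rot:
  assumes fin: "finite I" and U: "orth I U" and jk: "j \<in> I" "k \<in> I" "j \<noteq> k"
  shows "orth I (rot j k \<theta> U)"
  unfolding orth_def
proof (intro conjI ballI allI impI)
  fix a b assume ab: "a \<in> I" "b \<in> I"
  define c d where "c = cos \<theta>" and "d = sin \<theta>"
  have cd: "d * d = 1 - c * c"
    using sin_cos_squared_add[of \<theta>] by (simp add: power2_eq_square c_def d_def)
  have lin: "(\<Sum>l\<in>I. (x * U m l + y * U n l) * h l) = x * (\<Sum>l\<in>I. U m l * h l) + y * (\<Sum>l\<in>I. U n l * h l)"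
    "(\<Sum>l\<in>I. h l * (x * U m l + y * U n l)) = x * (\<Sum>l\<in>I. h l * U m l) + y * (\<Sum>l\<in>I. h l * U n l)"
    for x y m n h
    by (simp_all add: sum_distrib_left sum.distrib algebra_simps)
  have r: "rot j k \<theta> U j l = c * U j l + d * U k l" "rot j k \<theta> U k l = - d * U j l + c * U k l"
    "m \<noteq> j \<Longrightarrow> m \<noteq> k \<Longrightarrow> rot j k \<theta> U m l = U m l" for m l
    using jk by (simp_all add: rot_def c_def d_def)
  consider "a = j" | "a = k" | "a \<noteq> j" "a \<noteq> k" by blast
  then show "(\<Sum>l\<in>I. rot j k \<theta> U a l * rot j k \<theta> U b l) = (if a = b then 1 else 0)"
  proof cases
    case 1
    consider "b = j" | "b = k" | "b \<noteq> j" "b \<noteq> k" by blast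
    then show ?thesis
      using 1 jk ab by cases (simp_all only: r lin orth_row[OF U] simp_thms, simp_all add: cd)
  next
    case 2
    consider "b = j" | "b = k" | "b \<noteq> j" "b \<noteq> k" by blast
    then show ?thesis
      using 2 jk ab by cases (simp_all only: r lin orth_row[OF U] simp_thms, simp_all add: cd)
  next
    case 3
    consider "b = j" | "b = k" | "b \<noteq> j" "b \<noteq> k" by blast
    then show ?thesis
      using 3 jk ab by cases (simp_all only: r lin orth_row[OF U] simp_thms, simp_all)
  qed
  \<comment> \<open>For the columns only the summands of rows \<open>j\<close> and \<open>k\<close>
    change, and the sum of these two is preserved because cos^2 + sin^2 = 1.\<close>
  have "(\<Sum>l\<in>I. rot j k \<theta> U l a * rot j k \<theta> U l b) =
      rot j k \<theta> U j a * rot j k \<theta> U j b + rot j k \<theta> U k a * rot j k \<theta> U k b +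
      (\<Sum>l\<in>I - {j, k}. rot j k \<theta> U l a * rot j k \<theta> U l b)"
    by (rule sum_split2[OF fin jk])
  also have "(\<Sum>l\<in>I - {j, k}. rot j k \<theta> U l a * rot j k \<theta> U l b) = (\<Sum>l\<in>I - {j, k}. U l a * U l b)"
    by (intro sum.cong) (auto simp: rot_def)
  also have "rot j k \<theta> U j a * rot j k \<theta> U j b + rot j k \<theta> U k a * rot j k \<theta> U k b
      = (c * c + d * d) * (U j a * U j b + U k a * U k b)"
    unfolding r by (simp add: algebra_simps)
  also have "\<dots> = U j a * U j b + U k a * U k b" by (simp add: cd)
  also have "\<dots> + (\<Sum>l\<in>I - {j, k}. U l a * U l b) = (\<Sum>l\<in>I. U l a * U l b)"
    by (rule sum_split2[OF fin jk, symmetric])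
  also have "\<dots> = (if a = b then 1 else 0)" by (rule orth_col[OF U ab])
  finally show "(\<Sum>l\<in>I. rot j k \<theta> U l a * rot j k \<theta> U l b) = (if a = b then 1 else 0)" .
next
  fix a b assume "a \<notin> I \<or> b \<notin> I"
  then show "rot j k \<theta> U a b = 0"
    using jk by (auto simp: rot_def orth_outside[OF U])
qed

section \<open>Compactness of the orthogonal matrices and conditions at a minimum\<close>

text \<open>Tychonoff's theorem, carried over to the topology that the function type has as a type
  class instance.\<close>

lemma compact_PiE_UNIV:
  fixes S :: "'i \<Rightarrow> 'b::topological_space set"
  assumes "\<And>i. compact (S i)"
  shows "compact (PiE UNIV S)"
proof -
  have "compactin (product_topology (\<lambda>i. euclidean) UNIV) (PiE UNIV S)"
    using assms by (simp add: compactin_PiE)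
  then show ?thesis
    by (simp add: euclidean_product_topology)
qed

lemma continuous_on_entry: "continuous_on X (\<lambda>U. (U :: 'i \<Rightarrow> 'j \<Rightarrow> real) a b)"
proof -
  have "continuous_on X (\<lambda>U. (U :: 'i \<Rightarrow> 'j \<Rightarrow> real) a)"
    by (rule continuous_on_subset[OF continuous_on_product_coordinates]) simp
  then show ?thesis by (rule continuous_on_product_then_coordinatewise)
qed

text \<open>The index type may be infinite, so Tychonoff takes the place of Heine-Borel: the
  defining equations are closed conditions on the entries, and all entries lie in [-1, 1].\<close>

lemma compact_orth:
  assumes "finite I"
  shows "compact {U. orth I U}"
proof -
  let ?K = "PiE UNIV (\<lambda>_. PiE UNIV (\<lambda>_. {-1..1})) :: ('a \<Rightarrow> 'a \<Rightarrow> real) set"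
  have "compact ?K"
    by (intro compact_PiE_UNIV) auto
  moreover have "closed {U. orth I U}"
    unfolding orth_def Ball_def
    by (intro closed_Collect_conj closed_Collect_all closed_Collect_imp closed_Collect_eq
        continuous_intros continuous_on_entry) auto
  moreover have "{U. orth I U} = ?K \<inter> {U. orth I U}"
    using orth_abs_le[OF assms] by (auto simp: PiE_def abs_le_iff)
  ultimately show ?thesis
    by (metis compact_Int_closed)
qed

text \<open>If \<open>d\<close> were negative, the first derivative, which vanishes at 0, would be
  negative just to the right of 0, and the mean value theorem would give a value below the
  minimum.\<close>

lemma second_derivative_at_minimum:
  fixes \<phi> :: "real \<Rightarrow> real"
  assumes d1: "\<And>x. (\<phi> has_real_derivative \<phi>' x) (at x)"
    and d2: "(\<phi>' has_real_derivative d) (at 0)"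
    and min: "\<And>x. \<phi> 0 \<le> \<phi> x"
  shows "\<phi>' 0 = 0" "d \<ge> 0"
proof -
  show z: "\<phi>' 0 = 0"
    using DERIV_local_min[OF d1, of 1 0] min by auto
  show "d \<ge> 0"
  proof (rule ccontr)
    assume "\<not> d \<ge> 0"
    then obtain e where e: "e > 0" "\<And>h. 0 < h \<Longrightarrow> h < e \<Longrightarrow> \<phi>' (0 + h) < \<phi>' 0"
      using DERIV_neg_dec_right[OF d2] by auto
    obtain z where "0 < z" "z < e / 2" "\<phi> (e / 2) - \<phi> 0 = (e / 2 - 0) * \<phi>' z"
      using MVT2[of 0 "e / 2" \<phi> \<phi>'] d1 e(1) by auto
    moreover have "\<phi>' z < 0"
      using e(2)[of z] z calculation e(1) by auto
    ultimately have "\<phi> (e / 2) < \<phi> 0"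
      using e(1) by (smt (verit) mult_pos_neg half_gt_zero)
    with min show False by (meson not_le)
  qed
qed

text \<open>Compactness gives a minimiser \<open>U\<close> of the sum of \<open>F i\<close> over the
  diagonal values of all forms. Rotating two rows is an admissible curve through \<open>U\<close>,
  so along it the first derivative vanishes and the second is nonnegative. The two conditions say
  this, the first one divided by 2.\<close>

lemma orth_critical:
  fixes F F' F'' :: "'k \<Rightarrow> real \<Rightarrow> real" and p :: "'k \<Rightarrow> 'i \<Rightarrow> 'i \<Rightarrow> real"
  assumes fin: "finite I" "finite J"
    and sym: "\<And>i a b. i \<in> J \<Longrightarrow> a \<in> I \<Longrightarrow> b \<in> I \<Longrightarrow> p i a b = p i b a"
    and F': "\<And>i x. i \<in> J \<Longrightarrow> (F i has_real_derivative F' i x) (at x)"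
    and F'': "\<And>i x. i \<in> J \<Longrightarrow> (F' i has_real_derivative F'' i x) (at x)"
  shows "\<exists>U. orth I U \<and> (\<forall>j\<in>I. \<forall>k\<in>I. j \<noteq> k \<longrightarrow>
     (\<Sum>i\<in>J. (F' i (bil I (p i) (U j) (U j)) - F' i (bil I (p i) (U k) (U k))) * bil I (p i) (U j) (U k)) = 0 \<and>
     0 \<le> (\<Sum>i\<in>J. 4 * (F'' i (bil I (p i) (U j) (U j)) + F'' i (bil I (p i) (U k) (U k))) * (bil I (p i) (U j) (U k))\<^sup>2
        + 2 * (F' i (bil I (p i) (U j) (U j)) - F' i (bil I (p i) (U k) (U k))) *
              (bil I (p i) (U k) (U k) - bil I (p i) (U j) (U j))))"
proof -
  define \<Phi> where "\<Phi> U = (\<Sum>i\<in>J. \<Sum>j\<in>I. F i (bil I (p i) (U j) (U j)))" for U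
  have contF: "continuous_on UNIV (F i)" if "i \<in> J" for i
    using F'[OF that] by (intro DERIV_continuous_on) (auto intro: has_field_derivative_at_within)
  have "continuous_on {U. orth I U} \<Phi>"
    unfolding \<Phi>_def bil_def
    by (intro continuous_on_sum continuous_on_compose2[OF contF] continuous_intros continuous_on_entry) auto
  moreover have "{U. orth I U} \<noteq> {}"
    using orth_id[OF fin(1)] by blast
  ultimately obtain U where U: "orth I U" and min: "\<And>U'. orth I U' \<Longrightarrow> \<Phi> U \<le> \<Phi> U'"
    using continuous_attains_inf[OF compact_orth[OF fin(1)]] by blast
  have "(\<Sum>i\<in>J. (F' i (bil I (p i) (U j) (U j)) - F' i (bil I (p i) (U k) (U k))) * bil I (p i) (U j) (U k)) = 0 \<and>
     0 \<le> (\<Sum>i\<in>J. 4 * (F'' i (bil I (p i) (U j) (U j)) + F'' i (bil I (p i) (U k) (U k))) * (bil I (p i) (U j) (U k))\<^sup>2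
        + 2 * (F' i (bil I (p i) (U j) (U j)) - F' i (bil I (p i) (U k) (U k))) *
              (bil I (p i) (U k) (U k) - bil I (p i) (U j) (U j)))"
    if jk: "j \<in> I" "k \<in> I" "j \<noteq> k" for j k
  proof -
    define A where "A i = bil I (p i) (U j) (U j)" for i
    define C where "C i = bil I (p i) (U k) (U k)" for i
    define B where "B i = bil I (p i) (U j) (U k)" for i
    \<comment> \<open>\<open>\<alpha>\<close> and \<open>\<gamma>\<close> are the diagonal values of
      the form at the two rotated rows; \<open>\<delta>\<close> is the derivative of
      \<open>\<alpha>\<close> and the negative of that of \<open>\<gamma>\<close>, since the trace
      on the plane is constant.\<close>
    define \<alpha> where "\<alpha> i \<theta> = (cos \<theta>)\<^sup>2 * A i + (sin \<theta>)\<^sup>2 * C i + 2 * (sin \<theta> * cos \<theta>) * B i" for i \<theta>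
    define \<gamma> where "\<gamma> i \<theta> = (sin \<theta>)\<^sup>2 * A i + (cos \<theta>)\<^sup>2 * C i - 2 * (sin \<theta> * cos \<theta>) * B i" for i \<theta>
    define \<delta> where "\<delta> i \<theta> = 2 * (sin \<theta> * cos \<theta>) * (C i - A i) + 2 * ((cos \<theta>)\<^sup>2 - (sin \<theta>)\<^sup>2) * B i" for i \<theta>
    define \<phi> where "\<phi> \<theta> = (\<Sum>i\<in>J. F i (\<alpha> i \<theta>) + F i (\<gamma> i \<theta>))" for \<theta>
    define \<phi>' where "\<phi>' \<theta> = (\<Sum>i\<in>J. (F' i (\<alpha> i \<theta>) - F' i (\<gamma> i \<theta>)) * \<delta> i \<theta>)" for \<theta>
    have comm: "bil I (p i) (U k) (U j) = B i" if "i \<in> J" for i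
      unfolding B_def by (rule bil_commute) (use sym that in blast)
    have rotj: "bil I (p i) (rot j k \<theta> U j) (rot j k \<theta> U j) = \<alpha> i \<theta>" if "i \<in> J" for i \<theta>
      using jk comm[OF that] unfolding rot_def \<alpha>_def
      by (simp add: bil_add_left bil_add_right A_def[symmetric] B_def[symmetric] C_def[symmetric] power2_eq_square algebra_simps)
    have rotk: "bil I (p i) (rot j k \<theta> U k) (rot j k \<theta> U k) = \<gamma> i \<theta>" if "i \<in> J" for i \<theta>
    proof -
      have r: "rot j k \<theta> U k = (\<lambda>l. (- sin \<theta>) * U j l + cos \<theta> * U k l)"
        by (simp add: rot_def)
      show ?thesis
        unfolding r bil_add_left bil_add_right comm[OF that] \<gamma>_def
        by (simp add: A_def[symmetric] B_def[symmetric] C_def[symmetric] power2_eq_square algebra_simps)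
    qed
    \<comment> \<open>All rows other than \<open>j\<close> and \<open>k\<close> stay in place, so
      they contribute a constant and \<open>\<phi>\<close> inherits the minimum at 0.\<close>
    have \<Phi>rot: "\<Phi> (rot j k \<theta> U) = \<phi> \<theta> + (\<Sum>i\<in>J. \<Sum>l\<in>I - {j, k}. F i (bil I (p i) (U l) (U l)))" for \<theta>
    proof -
      have "(\<Sum>l\<in>I. F i (bil I (p i) (rot j k \<theta> U l) (rot j k \<theta> U l))) =
         F i (\<alpha> i \<theta>) + F i (\<gamma> i \<theta>) + (\<Sum>l\<in>I - {j, k}. F i (bil I (p i) (U l) (U l)))" if "i \<in> J" for i
        unfolding sum_split2[OF fin(1) jk] rotj[OF that] rotk[OF that]
        by (intro arg_cong2[where f = "(+)"] refl sum.cong) (auto simp: rot_def)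
      then show ?thesis
        by (simp add: \<Phi>_def \<phi>_def sum.distrib)
    qed
    have rot0: "rot j k 0 U = U" by (auto simp: rot_def)
    have "\<Phi> (rot j k 0 U) \<le> \<Phi> (rot j k \<theta> U)" for \<theta>
      unfolding rot0 by (intro min orth_rot[OF fin(1) U jk])
    then have min\<phi>: "\<phi> 0 \<le> \<phi> \<theta>" for \<theta>
      by (simp add: \<Phi>rot)
    have d\<alpha>: "(\<alpha> i has_real_derivative \<delta> i \<theta>) (at \<theta>)" for i \<theta>
      unfolding \<alpha>_def \<delta>_def
      by (rule derivative_eq_intros refl | simp)+ (simp add: power2_eq_square algebra_simps)
    have d\<gamma>: "(\<gamma> i has_real_derivative - \<delta> i \<theta>) (at \<theta>)" for i \<theta>
      unfolding \<gamma>_def \<delta>_def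
      by (rule derivative_eq_intros refl | simp)+ (simp add: power2_eq_square algebra_simps)
    have d\<delta>: "(\<delta> i has_real_derivative 2 * (C i - A i)) (at 0)" for i
      unfolding \<delta>_def by (rule derivative_eq_intros refl | simp)+
    have d\<phi>: "(\<phi> has_real_derivative \<phi>' \<theta>) (at \<theta>)" for \<theta>
    proof -
      have "((\<lambda>x. F i (\<alpha> i x) + F i (\<gamma> i x)) has_real_derivative (F' i (\<alpha> i \<theta>) - F' i (\<gamma> i \<theta>)) * \<delta> i \<theta>) (at \<theta>)"
        if "i \<in> J" for i
        using DERIV_add[OF DERIV_chain2[OF F'[OF that] d\<alpha>] DERIV_chain2[OF F'[OF that] d\<gamma>]]
        by (simp add: algebra_simps)
      then show ?thesis
        unfolding \<phi>_def \<phi>'_def by (rule DERIV_sum)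
    qed
    have v0: "\<alpha> i 0 = A i" "\<gamma> i 0 = C i" "\<delta> i 0 = 2 * B i" for i
      by (auto simp: \<alpha>_def \<gamma>_def \<delta>_def)
    have d\<phi>': "(\<phi>' has_real_derivative (\<Sum>i\<in>J. 4 * (F'' i (A i) + F'' i (C i)) * (B i)\<^sup>2
        + 2 * (F' i (A i) - F' i (C i)) * (C i - A i))) (at 0)"
    proof -
      have "((\<lambda>x. (F' i (\<alpha> i x) - F' i (\<gamma> i x)) * \<delta> i x) has_real_derivative
         4 * (F'' i (A i) + F'' i (C i)) * (B i)\<^sup>2 + 2 * (F' i (A i) - F' i (C i)) * (C i - A i)) (at 0)"
        if "i \<in> J" for i
        using DERIV_mult[OF DERIV_diff[OF DERIV_chain2[OF F''[OF that] d\<alpha>[of i 0]] DERIV_chain2[OF F''[OF that] d\<gamma>[of i 0]]] d\<delta>[of i]]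
        by (rule DERIV_cong) (simp add: v0 power2_eq_square algebra_simps)
      then show ?thesis
        unfolding \<phi>'_def by (rule DERIV_sum)
    qed
    have "\<phi>' 0 = 2 * (\<Sum>i\<in>J. (F' i (A i) - F' i (C i)) * B i)"
      unfolding \<phi>'_def v0 sum_distrib_left by (simp add: algebra_simps)
    with second_derivative_at_minimum[OF d\<phi> d\<phi>' min\<phi>] show ?thesis
      unfolding A_def B_def C_def by simp
  qed
  with U show ?thesis by blast
qed

section \<open>Expansions in the rows, invariants of forms, and diagonalisation\<close>

text \<open>Completeness of the rows: the column relations recover \<open>x\<close> from its
  coefficients along the rows of \<open>U\<close>.\<close>

lemma orth_expand:
  assumes fin: "finite I" and U: "orth I U" and "c \<in> I"
  shows "(\<Sum>j\<in>I. (\<Sum>a\<in>I. U j a * x a) * U j c) = (x c :: real)"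
proof -
  have "(\<Sum>j\<in>I. (\<Sum>a\<in>I. U j a * x a) * U j c) = (\<Sum>a\<in>I. \<Sum>j\<in>I. x a * (U j a * U j c))"
    unfolding sum_distrib_right by (subst sum.swap) (simp add: mult_ac)
  also have "\<dots> = (\<Sum>a\<in>I. if a = c then x a else 0)"
    unfolding sum_distrib_left[symmetric]
    by (intro sum.cong refl) (simp add: orth_col[OF U] \<open>c \<in> I\<close>)
  also have "\<dots> = x c"
    using fin \<open>c \<in> I\<close> by simp
  finally show ?thesis .
qed

lemma orth_parseval:
  fixes x y :: "'i \<Rightarrow> real"
  assumes fin: "finite I" and U: "orth I U"
  shows "(\<Sum>j\<in>I. (\<Sum>a\<in>I. U j a * x a) * (\<Sum>b\<in>I. U j b * y b)) = (\<Sum>a\<in>I. x a * y a)"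
proof -
  have "(\<Sum>j\<in>I. (\<Sum>a\<in>I. U j a * x a) * (\<Sum>b\<in>I. U j b * y b)) =
      (\<Sum>b\<in>I. (\<Sum>j\<in>I. (\<Sum>a\<in>I. U j a * x a) * U j b) * y b)"
    unfolding sum_distrib_left sum_distrib_right[of _ _ "y _"] by (subst sum.swap) (simp add: mult_ac)
  also have "\<dots> = (\<Sum>a\<in>I. x a * y a)"
    by (intro sum.cong refl) (simp add: orth_expand[OF fin U])
  finally show ?thesis .
qed

lemma orth_trace:
  assumes fin: "finite I" and U: "orth I U"
  shows "(\<Sum>j\<in>I. bil I p (U j) (U j)) = (\<Sum>a\<in>I. p a a)"
proof -
  have "(\<Sum>j\<in>I. bil I p (U j) (U j)) = (\<Sum>a\<in>I. \<Sum>j\<in>I. U j a * (\<Sum>b\<in>I. p a b * U j b))"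
    unfolding bil_alt by (rule sum.swap)
  also have "\<dots> = (\<Sum>a\<in>I. p a a)"
  proof (intro sum.cong refl)
    fix a assume "a \<in> I"
    then show "(\<Sum>j\<in>I. U j a * (\<Sum>b\<in>I. p a b * U j b)) = p a a"
      using orth_expand[OF fin U, of a "p a"] by (simp add: mult_ac)
  qed
  finally show ?thesis .
qed

text \<open>By symmetry \<open>bil I p x (U k)\<close> is the coefficient of the vector p x along
  row \<open>k\<close>, so Parseval applies.\<close>

lemma orth_bil_square_sum:
  assumes fin: "finite I" and U: "orth I U"
    and sym: "\<And>a b. a \<in> I \<Longrightarrow> b \<in> I \<Longrightarrow> p a b = p b a"
  shows "(\<Sum>k\<in>I. (bil I p x (U k))\<^sup>2) = (\<Sum>a\<in>I. (\<Sum>b\<in>I. p a b * x b)\<^sup>2)"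
proof -
  have "bil I p x (U k) = (\<Sum>a\<in>I. U k a * (\<Sum>b\<in>I. p a b * x b))" for k
    using bil_commute[OF sym, where x = x and y = "U k"] by (simp add: bil_alt)
  then show ?thesis
    using orth_parseval[OF fin U, of "\<lambda>a. \<Sum>b\<in>I. p a b * x b" "\<lambda>a. \<Sum>b\<in>I. p a b * x b"]
    by (simp add: power2_eq_square)
qed

text \<open>For two rows with diagonal values a, c and mixed value b, minimality for -x^2 amounts to
  (c - a) b = 0 and 16 b^2 <= 4 (c - a)^2. Either alternative of the first gives b = 0, so
  \<open>T\<close> is diagonal in the minimising basis.\<close>

lemma symmetric_diagonalisation:
  fixes T :: "'i \<Rightarrow> 'i \<Rightarrow> real"
  assumes fin: "finite I" and sym: "\<And>a b. a \<in> I \<Longrightarrow> b \<in> I \<Longrightarrow> T a b = T b a"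
  shows "\<exists>U \<mu>. orth I U \<and> (\<forall>j\<in>I. \<forall>a\<in>I. (\<Sum>b\<in>I. T a b * U j b) = \<mu> j * U j a)"
proof -
  have d: "((\<lambda>x. - x\<^sup>2) has_real_derivative - 2 * x) (at x)"
    "((\<lambda>x. - 2 * x) has_real_derivative - 2) (at x)" for x :: real
    by (auto intro!: derivative_eq_intros)
  have "\<exists>U. orth I U \<and> (\<forall>j\<in>I. \<forall>k\<in>I. j \<noteq> k \<longrightarrow>
      (bil I T (U k) (U k) = bil I T (U j) (U j) \<or> bil I T (U j) (U k) = 0) \<and>
      16 * (bil I T (U j) (U k))\<^sup>2 \<le>
        (4 * bil I T (U k) (U k) - 4 * bil I T (U j) (U j)) * (bil I T (U k) (U k) - bil I T (U j) (U j)))"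
    using orth_critical[where J = "{()}" and p = "\<lambda>_. T" and F = "\<lambda>_ x. - x\<^sup>2" and F' = "\<lambda>_ x. - 2 * x"
        and F'' = "\<lambda>_ _. - 2", OF fin _ sym d] by simp
  then obtain U where U: "orth I U" and crit: "\<And>j k. j \<in> I \<Longrightarrow> k \<in> I \<Longrightarrow> j \<noteq> k \<Longrightarrow>
      (bil I T (U k) (U k) = bil I T (U j) (U j) \<or> bil I T (U j) (U k) = 0) \<and>
      16 * (bil I T (U j) (U k))\<^sup>2 \<le>
        (4 * bil I T (U k) (U k) - 4 * bil I T (U j) (U j)) * (bil I T (U k) (U k) - bil I T (U j) (U j))"
    by blast
  have off: "bil I T (U j) (U k) = 0" if "j \<in> I" "k \<in> I" "j \<noteq> k" for j k
  proof (rule ccontr)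
    assume nz: "bil I T (U j) (U k) \<noteq> 0"
    with crit[OF that] have "bil I T (U j) (U j) = bil I T (U k) (U k)" by auto
    with crit[OF that] nz show False by auto
  qed
  have "(\<Sum>b\<in>I. T a b * U j b) = bil I T (U j) (U j) * U j a" if "j \<in> I" "a \<in> I" for j a
  proof -
    have "(\<Sum>b\<in>I. T a b * U j b) = (\<Sum>k\<in>I. bil I T (U k) (U j) * U k a)"
      unfolding bil_alt using orth_expand[OF fin U that(2), of "\<lambda>a. \<Sum>b\<in>I. T a b * U j b"] by simp
    also have "\<dots> = (\<Sum>k\<in>I. if k = j then bil I T (U j) (U j) * U j a else 0)"
      by (intro sum.cong refl) (simp add: off that)
    also have "\<dots> = bil I T (U j) (U j) * U j a" using fin that by simp
    finally show ?thesis .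
  qed
  with U show ?thesis by (intro exI[of _ U] exI[of _ "\<lambda>j. bil I T (U j) (U j)"]) blast
qed

text \<open>The second variations are summed over all pairs of basis vectors; for a pair of equal vectors
  convexity makes the corresponding term nonnegative.\<close>

lemma orth_convex_minimiser:
  fixes F F' F'' :: "'k \<Rightarrow> real \<Rightarrow> real" and p :: "'k \<Rightarrow> 'i \<Rightarrow> 'i \<Rightarrow> real"
  assumes fin: "finite I" "finite J"
    and sym: "\<And>i a b. i \<in> J \<Longrightarrow> a \<in> I \<Longrightarrow> b \<in> I \<Longrightarrow> p i a b = p i b a"
    and F': "\<And>i x. i \<in> J \<Longrightarrow> (F i has_real_derivative F' i x) (at x)"
    and F'': "\<And>i x. i \<in> J \<Longrightarrow> (F' i has_real_derivative F'' i x) (at x)"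
    and convex: "\<And>i x. i \<in> J \<Longrightarrow> F'' i x \<ge> 0"
  shows "\<exists>U. orth I U \<and>
    real (card I) * (\<Sum>i\<in>J. \<Sum>j\<in>I. F' i (bil I (p i) (U j) (U j)) * bil I (p i) (U j) (U j)) \<le>
    (\<Sum>i\<in>J. \<Sum>j\<in>I. (\<Sum>a\<in>I. p i a a) * F' i (bil I (p i) (U j) (U j)) +
       2 * F'' i (bil I (p i) (U j) (U j)) * (\<Sum>a\<in>I. (\<Sum>b\<in>I. p i a b * U j b)\<^sup>2))"
proof -
  obtain U where U: "orth I U" and crit: "\<And>j k. j \<in> I \<Longrightarrow> k \<in> I \<Longrightarrow> j \<noteq> k \<Longrightarrow>
     0 \<le> (\<Sum>i\<in>J. 4 * (F'' i (bil I (p i) (U j) (U j)) + F'' i (bil I (p i) (U k) (U k))) * (bil I (p i) (U j) (U k))\<^sup>2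
        + 2 * (F' i (bil I (p i) (U j) (U j)) - F' i (bil I (p i) (U k) (U k))) *
              (bil I (p i) (U k) (U k) - bil I (p i) (U j) (U j)))"
    using orth_critical[where I = I and J = J and p = p and F = F and F' = F' and F'' = F'', OF fin sym F' F'']
    by blast
  define A where "A i j = bil I (p i) (U j) (U j)" for i j
  define B where "B i j k = bil I (p i) (U j) (U k)" for i j k
  define n where "n = real (card I)"
  define tr where "tr i = (\<Sum>a\<in>I. p i a a)" for i
  define N where "N i j = (\<Sum>a\<in>I. (\<Sum>b\<in>I. p i a b * U j b)\<^sup>2)" for i j
  have trA: "(\<Sum>j\<in>I. A i j) = tr i" for i
    unfolding A_def tr_def by (rule orth_trace[OF fin(1) U])
  have BN: "(\<Sum>k\<in>I. (B i j k)\<^sup>2) = N i j" if "i \<in> J" for i j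
    unfolding B_def N_def by (rule orth_bil_square_sum[OF fin(1) U sym[OF that]])
  have Bsym: "B i j k = B i k j" if "i \<in> J" for i j k
    unfolding B_def by (rule bil_commute) (use sym that in blast)
  have nonneg: "0 \<le> (\<Sum>i\<in>J. 4 * (F'' i (A i j) + F'' i (A i k)) * (B i j k)\<^sup>2
        + 2 * (F' i (A i j) - F' i (A i k)) * (A i k - A i j))" if "j \<in> I" "k \<in> I" for j k
  proof (cases "j = k")
    case True
    then show ?thesis using convex by (auto intro!: sum_nonneg mult_nonneg_nonneg add_nonneg_nonneg)
  next
    case False
    from crit[OF that this] show ?thesis unfolding A_def B_def .
  qed
  \<comment> \<open>After expanding, the terms with \<open>F''\<close> collapse to \<open>N\<close>
    by Parseval, the mixed products of \<open>F'\<close> at one row with the value at the other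
    collapse to the trace, and the products at a single row are counted \<open>n\<close>
    times.\<close>
  have inner: "(\<Sum>j\<in>I. \<Sum>k\<in>I. 4 * (F'' i (A i j) + F'' i (A i k)) * (B i j k)\<^sup>2
        + 2 * (F' i (A i j) - F' i (A i k)) * (A i k - A i j))
      = 4 * (\<Sum>j\<in>I. tr i * F' i (A i j) + 2 * F'' i (A i j) * N i j) - 4 * (n * (\<Sum>j\<in>I. F' i (A i j) * A i j))"
    if i: "i \<in> J" for i
  proof -
    have scale: "(\<Sum>j\<in>I. \<Sum>k\<in>I. c * h j k) = c * (\<Sum>j\<in>I. \<Sum>k\<in>I. h j k)" for c :: real and h
      by (simp add: sum_distrib_left)
    have s1: "(\<Sum>j\<in>I. \<Sum>k\<in>I. F'' i (A i j) * (B i j k)\<^sup>2) = (\<Sum>j\<in>I. F'' i (A i j) * N i j)"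
      by (simp add: sum_distrib_left[symmetric] BN[OF i])
    have s2: "(\<Sum>j\<in>I. \<Sum>k\<in>I. F'' i (A i k) * (B i j k)\<^sup>2) = (\<Sum>j\<in>I. F'' i (A i j) * N i j)"
      unfolding s1[symmetric] by (subst sum.swap) (simp add: Bsym[OF i])
    have s3: "(\<Sum>j\<in>I. \<Sum>k\<in>I. F' i (A i j) * A i k) = (\<Sum>j\<in>I. tr i * F' i (A i j))"
      by (simp add: sum_distrib_left[symmetric] trA) (simp add: sum_distrib_left mult.commute)
    have s4: "(\<Sum>j\<in>I. \<Sum>k\<in>I. F' i (A i k) * A i j) = (\<Sum>j\<in>I. tr i * F' i (A i j))"
      unfolding s3[symmetric] by (rule sum.swap)
    have s5: "(\<Sum>j\<in>I. \<Sum>k\<in>I. F' i (A i j) * A i j) = n * (\<Sum>j\<in>I. F' i (A i j) * A i j)"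
      by (simp add: n_def sum_distrib_left)
    have s6: "(\<Sum>j\<in>I. \<Sum>k\<in>I. F' i (A i k) * A i k) = n * (\<Sum>j\<in>I. F' i (A i j) * A i j)"
      by (simp add: n_def)
    have "(\<Sum>j\<in>I. \<Sum>k\<in>I. 4 * (F'' i (A i j) + F'' i (A i k)) * (B i j k)\<^sup>2
        + 2 * (F' i (A i j) - F' i (A i k)) * (A i k - A i j)) =
      (\<Sum>j\<in>I. \<Sum>k\<in>I. 4 * (F'' i (A i j) * (B i j k)\<^sup>2) + 4 * (F'' i (A i k) * (B i j k)\<^sup>2)
        + 2 * (F' i (A i j) * A i k) + 2 * (F' i (A i k) * A i j)
        - 2 * (F' i (A i j) * A i j) - 2 * (F' i (A i k) * A i k))"
      by (intro sum.cong refl) (simp add: algebra_simps)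
    also have "\<dots> = 8 * (\<Sum>j\<in>I. F'' i (A i j) * N i j) + 4 * (\<Sum>j\<in>I. tr i * F' i (A i j))
        - 4 * (n * (\<Sum>j\<in>I. F' i (A i j) * A i j))"
      by (simp only: sum.distrib sum_subtractf scale s1 s2 s3 s4 s5 s6)
    finally show ?thesis
      by (simp add: sum.distrib sum_distrib_left[symmetric] mult.assoc)
  qed
  have swap3: "(\<Sum>j\<in>I. \<Sum>k\<in>I. \<Sum>i\<in>J. h i j k) = (\<Sum>i\<in>J. \<Sum>j\<in>I. \<Sum>k\<in>I. h i j k)" for h :: "'k \<Rightarrow> 'i \<Rightarrow> 'i \<Rightarrow> real"
  proof -
    have "(\<Sum>j\<in>I. \<Sum>k\<in>I. \<Sum>i\<in>J. h i j k) = (\<Sum>j\<in>I. \<Sum>i\<in>J. \<Sum>k\<in>I. h i j k)"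
      by (intro sum.cong refl sum.swap)
    also have "\<dots> = (\<Sum>i\<in>J. \<Sum>j\<in>I. \<Sum>k\<in>I. h i j k)" by (rule sum.swap)
    finally show ?thesis .
  qed
  have "0 \<le> (\<Sum>j\<in>I. \<Sum>k\<in>I. \<Sum>i\<in>J. 4 * (F'' i (A i j) + F'' i (A i k)) * (B i j k)\<^sup>2
        + 2 * (F' i (A i j) - F' i (A i k)) * (A i k - A i j))"
    by (intro sum_nonneg nonneg)
  also have "\<dots> = (\<Sum>i\<in>J. \<Sum>j\<in>I. \<Sum>k\<in>I. 4 * (F'' i (A i j) + F'' i (A i k)) * (B i j k)\<^sup>2
        + 2 * (F' i (A i j) - F' i (A i k)) * (A i k - A i j))"
    by (rule swap3)
  also have "\<dots> = 4 * (\<Sum>i\<in>J. \<Sum>j\<in>I. tr i * F' i (A i j) + 2 * F'' i (A i j) * N i j)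
      - 4 * (n * (\<Sum>i\<in>J. \<Sum>j\<in>I. F' i (A i j) * A i j))"
  proof -
    have "(\<Sum>i\<in>J. \<Sum>j\<in>I. \<Sum>k\<in>I. 4 * (F'' i (A i j) + F'' i (A i k)) * (B i j k)\<^sup>2
        + 2 * (F' i (A i j) - F' i (A i k)) * (A i k - A i j)) =
      (\<Sum>i\<in>J. 4 * (\<Sum>j\<in>I. tr i * F' i (A i j) + 2 * F'' i (A i j) * N i j) -
        4 * (n * (\<Sum>j\<in>I. F' i (A i j) * A i j)))"
      by (intro sum.cong refl inner)
    then show ?thesis by (simp add: sum_subtractf sum_distrib_left)
  qed
  finally have "n * (\<Sum>i\<in>J. \<Sum>j\<in>I. F' i (A i j) * A i j) \<le>
      (\<Sum>i\<in>J. \<Sum>j\<in>I. tr i * F' i (A i j) + 2 * F'' i (A i j) * N i j)"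
    by simp
  with U show ?thesis unfolding A_def tr_def N_def n_def by blast
qed

section \<open>The exponential potential and bases on which all forms are small\<close>

text \<open>The right side is the contribution of one form and one basis vector to the energy
  inequality of the minimiser, with \<open>u\<close> and \<open>w\<close> the scaled values of q and
  its square. The mixed term is split by a Young type inequality between \<open>cosh u\<close> and
  \<open>exp w\<close>; the losses that remain are at most 5/8 + 1/4, hence below 1.\<close>

lemma potential_lower_bound:
  fixes u w :: real
  assumes w: "w \<ge> 0"
  shows "3 / 8 * (\<bar>u\<bar> * exp \<bar>u\<bar>) - 1 \<le> u * sinh u - w / 4 * cosh u + (w / 2 - 1 / 4) * exp w"
proof -
  define v where "v = \<bar>u\<bar>"
  have v: "v \<ge> 0" by (simp add: v_def)
  have ev: "u * sinh u = v * sinh v" "cosh u = cosh v"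
    by (auto simp: v_def abs_if)
  have cosh_le: "cosh x \<le> exp x" if "x \<ge> 0" for x :: real
    using that by (simp add: cosh_def)
  have young: "w * cosh v \<le> v * cosh v + w * exp w"
  proof (cases "w \<le> v")
    case True
    have "w * cosh v \<le> v * cosh v" using True by (intro mult_right_mono) auto
    moreover have "0 \<le> w * exp w" using w by simp
    ultimately show ?thesis by linarith
  next
    case False
    have "cosh v \<le> cosh w" using False v by (simp add: cosh_real_nonneg_le_iff)
    also have "\<dots> \<le> exp w" by (rule cosh_le[OF w])
    finally have "w * cosh v \<le> w * exp w" using w by (rule mult_left_mono)
    moreover have "0 \<le> v * cosh v" using v by simp
    ultimately show ?thesis by linarith
  qed
  have a: "v * exp (- v) \<le> 1"
  proof -
    have "v \<le> exp v" using exp_ge_add_one_self[of v] by linarith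
    then have "v * exp (- v) \<le> exp v * exp (- v)" by (intro mult_right_mono) auto
    then show ?thesis by (simp add: exp_minus)
  qed
  have b: "(1 - w) * exp w \<le> 1"
  proof -
    have "1 - w \<le> exp (- w)" using exp_ge_add_one_self[of "- w"] by linarith
    then have "(1 - w) * exp w \<le> exp (- w) * exp w" by (intro mult_right_mono) auto
    then show ?thesis by (simp add: exp_minus)
  qed
  have "v * sinh v - v * cosh v / 4 = 3 / 8 * (v * exp v) - 5 / 8 * (v * exp (- v))"
    by (simp add: sinh_def cosh_def field_simps)
  with young a b have "3 / 8 * (v * exp v) - 1 \<le> v * sinh v - (w * cosh v) / 4 + (w / 2 - 1 / 4) * exp w"
    by (simp add: algebra_simps)
  then show ?thesis unfolding ev v_def[symmetric] by simp
qed


text \<open>The potential contains \<open>exp (\<parallel>q v\<parallel>\<^sup>2 / 4)\<close> because the second variation of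
  \<open>cosh (t \<langle>q v, v\<rangle>)\<close> produces a term with \<open>\<parallel>q v\<parallel>\<^sup>2\<close>, whose pointwise size is not controlled by the
  Hilbert-Schmidt norm. It is the value at \<open>v\<close> of the form \<open>q\<^sup>2\<close>, and \<open>\<parallel>q\<^sup>2 v\<parallel>\<^sup>2 \<le> n \<parallel>q v\<parallel>\<^sup>2\<close> closes the
  estimate.\<close>

lemma flat_orthonormal_basis:
  fixes q :: "nat \<Rightarrow> 'i \<Rightarrow> 'i \<Rightarrow> real"
  assumes fin: "finite I" and ne: "I \<noteq> {}"
    and sym: "\<And>i a b. i \<in> {1..M} \<Longrightarrow> a \<in> I \<Longrightarrow> b \<in> I \<Longrightarrow> q i a b = q i b a"
    and tr: "\<And>i. i \<in> {1..M} \<Longrightarrow> (\<Sum>a\<in>I. q i a a) = 0"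
    and hs: "\<And>i. i \<in> {1..M} \<Longrightarrow> (\<Sum>a\<in>I. \<Sum>b\<in>I. (q i a b)\<^sup>2) \<le> real (card I)"
  shows "\<exists>U. orth I U \<and> (\<forall>i\<in>{1..M}. \<forall>j\<in>I.
    \<bar>bil I (q i) (U j) (U j)\<bar> \<le> sqrt (32 / real (card I)) * ln (24 * real M * real (card I)))"
proof -
  define n where "n = real (card I)"
  have n: "n \<ge> 1"
    using fin ne by (simp add: n_def Suc_leI card_gt_0_iff)
  \<comment> \<open>The scale is chosen so that the second variation of \<open>cosh (t * x)\<close>
    carries the same factor \<open>n\<close> as the left side of the energy inequality: with
    \<open>C\<close> equal to \<open>4 * w\<close>, the term \<open>2 * t * t * C\<close> becomes
    \<open>n * w / 4\<close>.\<close>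
  define t where "t = sqrt (n / 32)"
  have t: "t > 0" "t * t = n / 32" using n by (auto simp: t_def)
  \<comment> \<open>The flag selects the form \<open>q i\<close> itself (False) or its square as a
    matrix (True).\<close>
  define J where "J = {1..M} \<times> (UNIV :: bool set)"
  define p where "p = (\<lambda>(i, s). if s then (\<lambda>a b. \<Sum>c\<in>I. q i a c * q i c b) else q i)"
  define F where "F = (\<lambda>(i :: nat, s) x. if s then exp (x / 4) else cosh (t * x))"
  define F' where "F' = (\<lambda>(i :: nat, s) x. if s then exp (x / 4) / 4 else t * sinh (t * x))"
  define F'' where "F'' = (\<lambda>(i :: nat, s) x. if s then exp (x / 4) / 16 else t * t * cosh (t * x))"
  have psym: "p i a b = p i b a" if "i \<in> J" "a \<in> I" "b \<in> I" for i a b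
  proof -
    obtain m s where i: "i = (m, s)" "m \<in> {1..M}" using \<open>i \<in> J\<close> by (auto simp: J_def)
    have "(\<Sum>c\<in>I. q m a c * q m c b) = (\<Sum>c\<in>I. q m b c * q m c a)"
      by (intro sum.cong refl) (metis i(2) sym that(2,3) mult.commute)
    then show ?thesis using i sym that by (simp add: p_def)
  qed
  have dF: "(F i has_real_derivative F' i x) (at x)" for i x
    by (cases i) (auto simp: F_def F'_def intro!: derivative_eq_intros)
  have dF': "(F' i has_real_derivative F'' i x) (at x)" for i x
    by (cases i) (auto simp: F'_def F''_def intro!: derivative_eq_intros)
  have convex: "F'' i x \<ge> 0" for i x
    using t by (cases i) (auto simp: F''_def)
  have "finite J" by (simp add: J_def)
  obtain U where U: "orth I U" and energy:
    "n * (\<Sum>i\<in>J. \<Sum>j\<in>I. F' i (bil I (p i) (U j) (U j)) * bil I (p i) (U j) (U j)) \<le>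
    (\<Sum>i\<in>J. \<Sum>j\<in>I. (\<Sum>a\<in>I. p i a a) * F' i (bil I (p i) (U j) (U j)) +
       2 * F'' i (bil I (p i) (U j) (U j)) * (\<Sum>a\<in>I. (\<Sum>b\<in>I. p i a b * U j b)\<^sup>2))"
    using orth_convex_minimiser[where I = I and J = J and p = p and F = F and F' = F' and F'' = F'',
        OF fin \<open>finite J\<close> psym dF dF' convex] unfolding n_def by blast
  define A where "A m j = bil I (q m) (U j) (U j)" for m j
  define y where "y m j a = (\<Sum>b\<in>I. q m a b * U j b)" for m j a
  define C where "C m j = (\<Sum>a\<in>I. (y m j a)\<^sup>2)" for m j
  have C0: "C m j \<ge> 0" for m j by (simp add: C_def sum_nonneg)
  have sq_app: "(\<Sum>b\<in>I. (\<Sum>c\<in>I. q m a c * q m c b) * U j b) = (\<Sum>c\<in>I. q m a c * y m j c)" for m j a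
    unfolding y_def sum_distrib_left sum_distrib_right by (subst sum.swap) (simp add: mult.assoc)
  have bilC: "bil I (\<lambda>a b. \<Sum>c\<in>I. q m a c * q m c b) (U j) (U j) = C m j" if "m \<in> {1..M}" for m j
  proof -
    have "bil I (\<lambda>a b. \<Sum>c\<in>I. q m a c * q m c b) (U j) (U j) = (\<Sum>c\<in>I. \<Sum>a\<in>I. U j a * (q m a c * y m j c))"
      unfolding bil_alt sq_app sum_distrib_left by (rule sum.swap)
    also have "\<dots> = (\<Sum>c\<in>I. y m j c * y m j c)"
    proof (intro sum.cong refl)
      fix c assume "c \<in> I"
      then show "(\<Sum>a\<in>I. U j a * (q m a c * y m j c)) = y m j c * y m j c"
        unfolding y_def[of m j c] sum_distrib_right
        by (intro sum.cong refl) (simp add: sym[OF that] y_def mult_ac)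
    qed
    finally show ?thesis by (simp add: C_def power2_eq_square)
  qed
  have trq: "(\<Sum>a\<in>I. \<Sum>c\<in>I. q m a c * q m c a) \<le> n" if "m \<in> {1..M}" for m
  proof -
    have "(\<Sum>a\<in>I. \<Sum>c\<in>I. q m a c * q m c a) = (\<Sum>a\<in>I. \<Sum>c\<in>I. (q m a c)\<^sup>2)"
      by (intro sum.cong refl) (simp add: sym[OF that] power2_eq_square)
    with hs[OF that] show ?thesis by (simp add: n_def)
  qed
  \<comment> \<open>By Cauchy-Schwarz the operator norm of \<open>q m\<close> is at most its
    Hilbert-Schmidt norm; \<open>y m j\<close> is already the image of row \<open>j\<close>, so the
    left side is the squared norm of the image of row \<open>j\<close> under the square of
    \<open>q m\<close>.\<close>
  have normq: "(\<Sum>a\<in>I. (\<Sum>c\<in>I. q m a c * y m j c)\<^sup>2) \<le> n * C m j" if "m \<in> {1..M}" for m j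
  proof -
    have "(\<Sum>a\<in>I. (\<Sum>c\<in>I. q m a c * y m j c)\<^sup>2) \<le> (\<Sum>a\<in>I. (\<Sum>c\<in>I. (q m a c)\<^sup>2) * C m j)"
      unfolding C_def by (intro sum_mono Cauchy_Schwarz_ineq_sum)
    also have "\<dots> \<le> n * C m j"
      unfolding sum_distrib_right[symmetric] n_def by (intro mult_right_mono hs that C0)
    finally show ?thesis .
  qed
  define u where "u m j = t * A m j" for m j
  define w where "w m j = C m j / 4" for m j
  define g where "g m j = u m j * sinh (u m j) - w m j / 4 * cosh (u m j) + (w m j / 2 - 1 / 4) * exp (w m j)" for m j
  have split: "(\<Sum>i\<in>J. h i) = (\<Sum>m\<in>{1..M}. h (m, False) + h (m, True))" for h :: "nat \<times> bool \<Rightarrow> real"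
    unfolding J_def sum.cartesian_product[symmetric, of "\<lambda>a b. h (a, b)", simplified] by (simp add: UNIV_bool)
  have lhs: "(\<Sum>i\<in>J. \<Sum>j\<in>I. F' i (bil I (p i) (U j) (U j)) * bil I (p i) (U j) (U j)) =
      (\<Sum>m\<in>{1..M}. \<Sum>j\<in>I. u m j * sinh (u m j) + w m j * exp (w m j))"
    unfolding split
    by (intro sum.cong refl)
      (simp add: F'_def p_def bilC A_def[symmetric] u_def w_def sum.distrib mult_ac)
  have rhs: "(\<Sum>i\<in>J. \<Sum>j\<in>I. (\<Sum>a\<in>I. p i a a) * F' i (bil I (p i) (U j) (U j)) +
       2 * F'' i (bil I (p i) (U j) (U j)) * (\<Sum>a\<in>I. (\<Sum>b\<in>I. p i a b * U j b)\<^sup>2)) \<le>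
      (\<Sum>m\<in>{1..M}. \<Sum>j\<in>I. n * (w m j / 4 * cosh (u m j) + exp (w m j) / 4 + w m j * exp (w m j) / 2))"
    unfolding split sum.distrib[symmetric]
  proof (intro sum_mono)
    \<comment> \<open>The trace of \<open>q m\<close> is zero, so its flag contributes only the
      second variation. For the square the trace is the squared Hilbert-Schmidt norm, at most
      \<open>n\<close>, and \<open>normq\<close> bounds the other term.\<close>
    fix m j assume m: "m \<in> {1..M}" and j: "j \<in> I"
    have "(\<Sum>a\<in>I. p (m, False) a a) * F' (m, False) (bil I (p (m, False)) (U j) (U j)) +
        2 * F'' (m, False) (bil I (p (m, False)) (U j) (U j)) * (\<Sum>a\<in>I. (\<Sum>b\<in>I. p (m, False) a b * U j b)\<^sup>2)
      = n * (w m j / 4 * cosh (u m j))"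
      by (simp add: p_def F'_def F''_def tr[OF m] t(2) A_def[symmetric] y_def[symmetric] C_def[symmetric]
          u_def[symmetric] w_def)
    moreover have "(\<Sum>a\<in>I. p (m, True) a a) * F' (m, True) (bil I (p (m, True)) (U j) (U j))
      \<le> n * (exp (w m j) / 4)"
      using trq[OF m] by (simp add: p_def F'_def bilC[OF m] w_def)
    moreover have "2 * F'' (m, True) (bil I (p (m, True)) (U j) (U j)) * (\<Sum>a\<in>I. (\<Sum>b\<in>I. p (m, True) a b * U j b)\<^sup>2)
      \<le> n * (w m j * exp (w m j) / 2)"
      using mult_left_mono[OF normq[OF m, of j], of "exp (w m j) / 8"]
      by (simp add: p_def F''_def bilC[OF m] w_def sq_app)
    ultimately show "(\<Sum>a\<in>I. p (m, False) a a) * F' (m, False) (bil I (p (m, False)) (U j) (U j)) +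
        2 * F'' (m, False) (bil I (p (m, False)) (U j) (U j)) * (\<Sum>a\<in>I. (\<Sum>b\<in>I. p (m, False) a b * U j b)\<^sup>2) +
        ((\<Sum>a\<in>I. p (m, True) a a) * F' (m, True) (bil I (p (m, True)) (U j) (U j)) +
        2 * F'' (m, True) (bil I (p (m, True)) (U j) (U j)) * (\<Sum>a\<in>I. (\<Sum>b\<in>I. p (m, True) a b * U j b)\<^sup>2))
      \<le> n * (w m j / 4 * cosh (u m j) + exp (w m j) / 4 + w m j * exp (w m j) / 2)"
      by (simp add: algebra_simps)
  qed
  have "n * (\<Sum>m\<in>{1..M}. \<Sum>j\<in>I. u m j * sinh (u m j) + w m j * exp (w m j)) \<le>
      n * (\<Sum>m\<in>{1..M}. \<Sum>j\<in>I. w m j / 4 * cosh (u m j) + exp (w m j) / 4 + w m j * exp (w m j) / 2)"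
    using energy rhs unfolding lhs sum_distrib_left[symmetric] by (rule order_trans)
  then have "(\<Sum>m\<in>{1..M}. \<Sum>j\<in>I. u m j * sinh (u m j) + w m j * exp (w m j)) \<le>
      (\<Sum>m\<in>{1..M}. \<Sum>j\<in>I. w m j / 4 * cosh (u m j) + exp (w m j) / 4 + w m j * exp (w m j) / 2)"
    using n by simp
  moreover have "(\<Sum>m\<in>{1..M}. \<Sum>j\<in>I. g m j) =
      (\<Sum>m\<in>{1..M}. \<Sum>j\<in>I. u m j * sinh (u m j) + w m j * exp (w m j)) -
      (\<Sum>m\<in>{1..M}. \<Sum>j\<in>I. w m j / 4 * cosh (u m j) + exp (w m j) / 4 + w m j * exp (w m j) / 2)"
    unfolding sum_subtractf[symmetric] by (intro sum.cong refl) (simp add: g_def algebra_simps)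
  ultimately have g_sum: "(\<Sum>m\<in>{1..M}. \<Sum>j\<in>I. g m j) \<le> 0" by linarith
  have "(\<Sum>m\<in>{1..M}. \<Sum>j\<in>I. 3 / 8 * (\<bar>u m j\<bar> * exp \<bar>u m j\<bar>) - 1) \<le> (\<Sum>m\<in>{1..M}. \<Sum>j\<in>I. g m j)"
    unfolding g_def by (intro sum_mono potential_lower_bound) (simp add: w_def C0)
  then have total: "(\<Sum>m\<in>{1..M}. \<Sum>j\<in>I. 3 / 8 * (\<bar>u m j\<bar> * exp \<bar>u m j\<bar>)) \<le> real M * n"
    using g_sum by (simp add: sum_subtractf n_def)
  have "\<bar>A m j\<bar> \<le> sqrt (32 / n) * ln (24 * real M * n)" if m: "m \<in> {1..M}" and j: "j \<in> I" for m j
  proof -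
    have "3 / 8 * (\<bar>u m j\<bar> * exp \<bar>u m j\<bar>) \<le> (\<Sum>j\<in>I. 3 / 8 * (\<bar>u m j\<bar> * exp \<bar>u m j\<bar>))"
      using fin j by (intro member_le_sum) auto
    also have "\<dots> \<le> (\<Sum>m\<in>{1..M}. \<Sum>j\<in>I. 3 / 8 * (\<bar>u m j\<bar> * exp \<bar>u m j\<bar>))"
      using m by (intro member_le_sum[where f = "\<lambda>m. \<Sum>j\<in>I. 3 / 8 * (\<bar>u m j\<bar> * exp \<bar>u m j\<bar>)"] sum_nonneg) auto
    also note total
    finally have le: "3 / 8 * (\<bar>u m j\<bar> * exp \<bar>u m j\<bar>) \<le> real M * n" .
    \<comment> \<open>If \<open>\<bar>u m j\<bar>\<close> exceeds 1, then \<open>le\<close> gives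
      \<open>exp \<bar>u m j\<bar>\<close> at most 8/3 times \<open>real M * n\<close>; otherwise
      \<open>exp 1\<close> is below 24. The larger constant 24 serves both cases and matches the
      factor 1/24 in the bound on the number of functions.\<close>
    have "real M \<ge> 1" using m by auto
    then have Mn: "real M * n \<ge> 1" using n by (metis mult_mono mult_1 zero_le_one order_trans)
    then have Mn24: "24 * real M * n \<ge> 24" by simp
    then have pos: "24 * real M * n > 0" by linarith
    have "\<bar>u m j\<bar> \<le> ln (24 * real M * n)"
    proof (cases "\<bar>u m j\<bar> \<le> 1")
      case True
      have "exp 1 \<le> (24 :: real)" using exp_le by simp
      also note Mn24
      finally have "1 \<le> ln (24 * real M * n)" using pos by (subst ln_ge_iff)
      with True show ?thesis by simp
    next
      case False
      then have "exp \<bar>u m j\<bar> \<le> \<bar>u m j\<bar> * exp \<bar>u m j\<bar>" by simp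
      also have "\<dots> \<le> 24 * real M * n" using le Mn by simp
      finally show ?thesis using pos by (subst ln_ge_iff)
    qed
    then have "\<bar>u m j\<bar> * sqrt (32 / n) \<le> ln (24 * real M * n) * sqrt (32 / n)"
      using n by (intro mult_right_mono) auto
    moreover have "sqrt (32 / n) = 1 / t" by (simp add: t_def real_sqrt_divide)
    then have "\<bar>A m j\<bar> = \<bar>u m j\<bar> * sqrt (32 / n)" using t by (simp add: u_def abs_mult)
    ultimately show ?thesis by (simp add: mult.commute)
  qed
  with U show ?thesis unfolding A_def n_def by blast
qed

section \<open>Products and block sums of orthogonal matrices\<close>

lemma orth_transpose: "orth I U \<Longrightarrow> orth I (\<lambda>j k. U k j)"
  unfolding orth_def by blast

lemma orth_mult:
  assumes fin: "finite I" and W: "orth I W" and U: "orth I U"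
  shows "orth I (\<lambda>j g. \<Sum>k\<in>I. W j k * U k g)"
  unfolding orth_def
proof (intro conjI ballI allI impI)
  fix a b assume ab: "a \<in> I" "b \<in> I"
  show "(\<Sum>j\<in>I. (\<Sum>k\<in>I. W j k * U k a) * (\<Sum>k\<in>I. W j k * U k b)) = (if a = b then 1 else 0)"
    using orth_parseval[OF fin W, of "\<lambda>k. U k a" "\<lambda>k. U k b"] orth_col[OF U ab] by simp
  show "(\<Sum>g\<in>I. (\<Sum>k\<in>I. W a k * U k g) * (\<Sum>k\<in>I. W b k * U k g)) = (if a = b then 1 else 0)"
    using orth_parseval[OF fin orth_transpose[OF U], of "W a" "W b"] orth_row[OF W ab]
    by (simp add: mult.commute)
next
  fix a b assume "a \<notin> I \<or> b \<notin> I"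
  then show "(\<Sum>k\<in>I. W a k * U k b) = 0"
    using orth_outside[OF W] orth_outside[OF U] by (auto intro!: sum.neutral)
qed

text \<open>Independent changes of basis on the level sets of \<open>\<mu>\<close> combine into one
  orthogonal matrix, since row \<open>j\<close> is supported on its own level set. The family
  \<open>V\<close> is indexed by all values; on an empty level set it is the zero matrix.\<close>

lemma orth_block:
  assumes fin: "finite I" and V: "\<And>c. orth {k \<in> I. \<mu> k = c} (V c)"
  shows "orth I (\<lambda>j k. V (\<mu> j) j k)"
  unfolding orth_def
proof (intro conjI ballI allI impI)
  fix a b assume ab: "a \<in> I" "b \<in> I"
  have out: "V c j k = 0" if "\<mu> j \<noteq> c \<or> \<mu> k \<noteq> c" for c j k
    using orth_outside[OF V] that by blast
  have restrict: "sum h I = sum h {k \<in> I. \<mu> k = c}" if "\<And>k. \<mu> k \<noteq> c \<Longrightarrow> h k = 0" for h :: "'a \<Rightarrow> real" and c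
    using that fin by (intro sum.mono_neutral_right) auto
  show "(\<Sum>l\<in>I. V (\<mu> a) a l * V (\<mu> b) b l) = (if a = b then 1 else 0)"
  proof (cases "\<mu> a = \<mu> b")
    case True
    have "(\<Sum>l\<in>I. V (\<mu> a) a l * V (\<mu> b) b l) = (\<Sum>l\<in>{k \<in> I. \<mu> k = \<mu> a}. V (\<mu> a) a l * V (\<mu> a) b l)"
      unfolding True[symmetric] by (intro restrict) (simp add: out)
    also have "\<dots> = (if a = b then 1 else 0)"
      by (rule orth_row[OF V]) (use ab True in auto)
    finally show ?thesis .
  next
    case False
    have "V (\<mu> a) a l * V (\<mu> b) b l = 0" for l using out[of l] False by (metis mult_eq_0_iff out)
    with False show ?thesis by auto
  qed
  show "(\<Sum>l\<in>I. V (\<mu> l) l a * V (\<mu> l) l b) = (if a = b then 1 else 0)"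
  proof (cases "\<mu> a = \<mu> b")
    case True
    have "(\<Sum>l\<in>I. V (\<mu> l) l a * V (\<mu> l) l b) = (\<Sum>l\<in>{k \<in> I. \<mu> k = \<mu> a}. V (\<mu> l) l a * V (\<mu> l) l b)"
      by (intro restrict) (metis mult_eq_0_iff out)
    also have "\<dots> = (\<Sum>l\<in>{k \<in> I. \<mu> k = \<mu> a}. V (\<mu> a) l a * V (\<mu> a) l b)"
      by (intro sum.cong) auto
    also have "\<dots> = (if a = b then 1 else 0)"
      by (rule orth_col[OF V]) (use ab True in auto)
    finally show ?thesis .
  next
    case False
    have "V (\<mu> l) l a * V (\<mu> l) l b = 0" for l using False by (metis mult_eq_0_iff out)
    with False show ?thesis by auto
  qed
next
  fix a b assume "a \<notin> I \<or> b \<notin> I"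
  then show "V (\<mu> a) a b = 0" using orth_outside[OF V] by blast
qed

section \<open>Representations without fixed vectors\<close>

text \<open>The homomorphism laws stated on matrices alone. Invertibility follows from the value at
  the unit, with the image of \<open>inv g\<close> as the inverse of
  \<open>\<sigma> g\<close>.\<close>

definition matrix_rep :: "('a, 'b) monoid_scheme \<Rightarrow> nat \<Rightarrow> ('a \<Rightarrow> complex mat) \<Rightarrow> bool" where
  "matrix_rep G n \<sigma> \<longleftrightarrow>
     (\<forall>g\<in>carrier G. \<sigma> g \<in> carrier_mat n n) \<and>
     (\<forall>g\<in>carrier G. \<forall>h\<in>carrier G. \<sigma> (g \<otimes>\<^bsub>G\<^esub> h) = \<sigma> g * \<sigma> h) \<and>
     \<sigma> \<one>\<^bsub>G\<^esub> = 1\<^sub>m n"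

lemma matrix_rep_representation:
  assumes "group G" and \<sigma>: "matrix_rep G n \<sigma>"
  shows "representation G n \<sigma>"
proof -
  interpret group G by fact
  have "\<sigma> g \<in> Units (ring_mat TYPE(complex) n ())" if "g \<in> carrier G" for g
  proof -
    have "\<sigma> (inv\<^bsub>G\<^esub> g) * \<sigma> g = 1\<^sub>m n" "\<sigma> g * \<sigma> (inv\<^bsub>G\<^esub> g) = 1\<^sub>m n"
      using \<sigma> that by (metis inv_closed l_inv matrix_rep_def, metis inv_closed r_inv matrix_rep_def)
    moreover have "\<sigma> g \<in> carrier_mat n n" "\<sigma> (inv\<^bsub>G\<^esub> g) \<in> carrier_mat n n"
      using \<sigma> that by (auto simp: matrix_rep_def)
    ultimately show ?thesis
      by (auto simp: Units_def ring_mat_simps)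
  qed
  then show ?thesis
    using \<sigma> by (auto simp: representation_def hom_def units_of_def matrix_rep_def ring_mat_simps)
qed

text \<open>The columns of \<open>B\<close> form a basis of \<open>W\<close>, so \<open>B\<close>
  identifies the coordinate space of dimension \<open>r\<close> with \<open>W\<close>. That
  \<open>W\<close> is neither zero nor everything gives the strict bounds on \<open>r\<close>, on
  which the induction over dimensions rests.\<close>

lemma (in vec_space) proper_subspace_basis_matrix:
  assumes W: "VectorSpace.subspace class_ring W V" "W \<noteq> {0\<^sub>v n}" "W \<noteq> carrier_vec n"
  shows "\<exists>r B. 0 < r \<and> r < n \<and> B \<in> carrier_mat n r \<and>
    (\<forall>x\<in>carrier_vec r. B *\<^sub>v x = 0\<^sub>v n \<longrightarrow> x = 0\<^sub>v r) \<and>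
    W = (\<lambda>x. B *\<^sub>v x) ` carrier_vec r"
proof -
  have sub: "submodule class_ring W V" using W(1) by (simp add: subspace_def)
  have Wc: "W \<subseteq> carrier_vec n" using submodule.subset[OF sub] by simp
  have W0: "0\<^sub>v n \<in> W" using submodule.zero_closed[OF sub] by simp
  \<comment> \<open>Independent subsets have at most \<open>n\<close> elements, so a maximal one
    inside \<open>W\<close> exists; maximality then forces it to span \<open>W\<close>.\<close>
  obtain A where A: "finite A" "maximal A (\<lambda>S. S \<subseteq> W \<and> lin_indpt S)"
  proof -
    have "finite S \<and> card S \<le> n" if "S \<subseteq> W \<and> lin_indpt S" for S
      using li_le_dim[OF fin_dim, of S] that Wc by (auto simp: dim_is_n)
    moreover have "{} \<subseteq> W \<and> lin_indpt {}" by (simp add: lin_dep_def)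
    ultimately show ?thesis
      using that maximal_exists[of "\<lambda>S. S \<subseteq> W \<and> lin_indpt S" n "{}"] by blast
  qed
  have AW: "A \<subseteq> W" and li: "lin_indpt A" using A(2) by (auto simp: maximal_def)
  have Ac: "A \<subseteq> carrier_vec n" using AW Wc by auto
  have span: "W = span A"
  proof
    show "span A \<subseteq> W" using span_is_subset[OF AW sub] .
    show "W \<subseteq> span A"
    proof
      fix w assume w: "w \<in> W"
      show "w \<in> span A"
      proof (rule ccontr)
        assume ns: "w \<notin> span A"
        then have "w \<notin> A" using in_own_span[OF Ac] by auto
        moreover have "lin_indpt (A \<union> {w})"
          using lin_dep_iff_in_span[OF Ac li, of w] w Wc ns \<open>w \<notin> A\<close> by auto
        ultimately show False
          using A(2) AW w unfolding maximal_def by (metis Un_insert_right Un_empty_right insertI1 insert_subset subset_insertI)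
      qed
    qed
  qed
  obtain xs where xs: "set xs = A" "distinct xs" using finite_distinct_list[OF A(1)] by blast
  define r where "r = length xs"
  have rA: "r = card A" using distinct_card[OF xs(2)] xs(1) by (simp add: r_def)
  define B where "B = mat_of_cols n xs"
  have B: "B \<in> carrier_mat n r" by (simp add: B_def r_def)
  have mult: "B *\<^sub>v vec r (\<lambda>i. f (xs ! i)) = lincomb f A" for f
  proof -
    have "lincomb f A = lincomb_list (\<lambda>i. f (xs ! i)) xs"
      using lincomb_as_lincomb_list_distinct[of xs f] xs Ac by simp
    also have "\<dots> = B *\<^sub>v vec r (\<lambda>i. f (xs ! i))"
      unfolding B_def r_def by (rule lincomb_list_as_mat_mult) (use xs Ac in auto)
    finally show ?thesis by simp
  qed
  have vec_rep: "\<exists>f. x = vec r (\<lambda>i. f (xs ! i))" if x: "x \<in> carrier_vec r" for x :: "'a vec"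
  proof -
    \<comment> \<open>Linear combinations take coefficients indexed by vectors, so the position of a
      vector in the distinct list \<open>xs\<close> is recovered with a definite
      description.\<close>
    have "x = vec r (\<lambda>i. (\<lambda>v. x $ (THE i. i < r \<and> xs ! i = v)) (xs ! i))"
    proof (rule eq_vecI)
      fix i assume "i < dim_vec (vec r (\<lambda>i. (\<lambda>v. x $ (THE i. i < r \<and> xs ! i = v)) (xs ! i)))"
      then have "i < r" by simp
      moreover have "(THE j. j < r \<and> xs ! j = xs ! i) = i"
        using \<open>i < r\<close> xs(2) by (auto simp: r_def nth_eq_iff_index_eq)
      ultimately show "x $ i = vec r (\<lambda>i. (\<lambda>v. x $ (THE i. i < r \<and> xs ! i = v)) (xs ! i)) $ i"
        by simp
    qed (use x in auto)
    then show ?thesis by (intro exI[of _ "\<lambda>v. x $ (THE i. i < r \<and> xs ! i = v)"])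
  qed
  have inj: "x = 0\<^sub>v r" if x: "x \<in> carrier_vec r" "B *\<^sub>v x = 0\<^sub>v n" for x
  proof -
    obtain f where f: "x = vec r (\<lambda>i. f (xs ! i))" using vec_rep[OF x(1)] by blast
    then have "lincomb f A = 0\<^sub>v n" using mult x(2) by simp
    then have "f v = 0" if "v \<in> A" for v
      using not_lindepD[OF li A(1) subset_refl, of f] that by auto
    then show ?thesis unfolding f using xs by (auto simp: r_def)
  qed
  have img: "W = (\<lambda>x. B *\<^sub>v x) ` carrier_vec r"
  proof
    show "W \<subseteq> (\<lambda>x. B *\<^sub>v x) ` carrier_vec r"
    proof
      fix w assume "w \<in> W"
      then obtain f where "w = lincomb f A"
        using finite_in_span[OF A(1) Ac] span by auto
      then show "w \<in> (\<lambda>x. B *\<^sub>v x) ` carrier_vec r"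
        using mult[of f] by (intro image_eqI[of _ _ "vec r (\<lambda>i. f (xs ! i))"]) auto
    qed
    show "(\<lambda>x. B *\<^sub>v x) ` carrier_vec r \<subseteq> W"
    proof
      fix w assume "w \<in> (\<lambda>x. B *\<^sub>v x) ` carrier_vec r"
      then obtain x where "x \<in> carrier_vec r" "w = B *\<^sub>v x" by blast
      then obtain f where "w = lincomb f A" using vec_rep mult by metis
      then show "w \<in> W" unfolding span using A(1) by (auto simp: span_def)
    qed
  qed
  have "r > 0"
  proof (rule ccontr)
    assume "\<not> r > 0"
    then have "A = {}" using rA A(1) by simp
    then show False using W(2) span by (simp add: span_empty)
  qed
  moreover have "r < n"
  proof (rule ccontr)
    assume "\<not> r < n"
    then have "basis A"
      using dim_li_is_basis[OF fin_dim A(1) _ li] Ac rA by (simp add: dim_is_n)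
    then show False using W(3) span by (simp add: basis_def)
  qed
  ultimately show ?thesis using B inj img by blast
qed

text \<open>Injectivity applied column by column. It transfers the homomorphism laws from a
  representation to its restriction to the column space of \<open>B\<close>.\<close>

lemma mat_mult_left_cancel:
  fixes B :: "complex mat"
  assumes B: "B \<in> carrier_mat n r"
    and inj: "\<And>x. x \<in> carrier_vec r \<Longrightarrow> B *\<^sub>v x = 0\<^sub>v n \<Longrightarrow> x = 0\<^sub>v r"
    and X: "X \<in> carrier_mat r k" and Y: "Y \<in> carrier_mat r k" and eq: "B * X = B * Y"
  shows "X = Y"
proof (rule eq_matI)
  fix i j assume ij: "i < dim_row Y" "j < dim_col Y"
  have c: "col X j \<in> carrier_vec r" "col Y j \<in> carrier_vec r" using X Y by auto
  have "B *\<^sub>v col X j = B *\<^sub>v col Y j"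
    using eq ij B X Y by (metis carrier_matD(2) col_mult2)
  then have "B *\<^sub>v (col X j - col Y j) = 0\<^sub>v n"
    using B c by (simp add: mult_minus_distrib_mat_vec)
  then have "col X j - col Y j = 0\<^sub>v r" using inj c by auto
  then have "(col X j - col Y j) $ i = 0" using ij Y by simp
  then show "X $$ (i, j) = Y $$ (i, j)" using ij X Y by simp
qed (use X Y in auto)

text \<open>A reducible representation is replaced by its restriction to a proper invariant subspace.\<close>

lemma min_rep_dim_le:
  assumes G: "group G" and \<sigma>: "matrix_rep G n \<sigma>" and "n > 0"
    and nofix: "\<And>x. x \<in> carrier_vec n \<Longrightarrow> (\<And>g. g \<in> carrier G \<Longrightarrow> \<sigma> g *\<^sub>v x = x) \<Longrightarrow> x = 0\<^sub>v n"
  shows "min_rep_dim G \<le> n"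
  using \<sigma> \<open>n > 0\<close> nofix
proof (induction n arbitrary: \<sigma> rule: less_induct)
  case (less n)
  interpret group G by (rule G)
  interpret vec_space "TYPE(complex)" n .
  have cm: "\<sigma> g \<in> carrier_mat n n" if "g \<in> carrier G" for g
    using less.prems(1) that by (simp add: matrix_rep_def)
  show ?case
  proof (cases "irreducible_rep G n \<sigma>")
    case True
    \<comment> \<open>A trivial representation would fix the first unit vector.\<close>
    have "\<not> trivial_rep G n \<sigma>"
    proof
      assume "trivial_rep G n \<sigma>"
      then have "n = 1" "\<And>g. g \<in> carrier G \<Longrightarrow> \<sigma> g = 1\<^sub>m n" by (auto simp: trivial_rep_def)
      then have "unit_vec n 0 = 0\<^sub>v n" using less.prems(3)[of "unit_vec n 0"] by auto
      then have "unit_vec n 0 $ 0 = (0 :: complex)" using less.prems(2) by simp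
      then show False using less.prems(2) by simp
    qed
    with True show ?thesis unfolding min_rep_dim_def by (intro Least_le) blast
  next
    case False
    then obtain W where W: "VectorSpace.subspace class_ring W V" "W \<noteq> {0\<^sub>v n}" "W \<noteq> carrier_vec n"
      and Winv: "\<And>g w. g \<in> carrier G \<Longrightarrow> w \<in> W \<Longrightarrow> \<sigma> g *\<^sub>v w \<in> W"
      using matrix_rep_representation[OF G less.prems(1)] less.prems(2)
      unfolding irreducible_rep_def by blast
    obtain r B where r: "0 < r" "r < n" and B: "B \<in> carrier_mat n r"
      and inj: "\<And>x. x \<in> carrier_vec r \<Longrightarrow> B *\<^sub>v x = 0\<^sub>v n \<Longrightarrow> x = 0\<^sub>v r"
      and img: "W = (\<lambda>x. B *\<^sub>v x) ` carrier_vec r"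
      using proper_subspace_basis_matrix[OF W] by blast
    \<comment> \<open>The matrix of the restriction: column \<open>i\<close> of \<open>X\<close>
      holds the coordinates of the image of column \<open>i\<close> of \<open>B\<close>, which lies
      in \<open>W\<close> by invariance.\<close>
    have "\<exists>X. X \<in> carrier_mat r r \<and> \<sigma> g * B = B * X" if g: "g \<in> carrier G" for g
    proof -
      have "\<exists>y. y \<in> carrier_vec r \<and> \<sigma> g *\<^sub>v col B i = B *\<^sub>v y" if i: "i < r" for i
      proof -
        have "B *\<^sub>v unit_vec r i = col B i"
          using B i by (intro eq_vecI) auto
        then have "col B i \<in> W" unfolding img by (metis image_eqI unit_vec_carrier)
        from Winv[OF g this] show ?thesis unfolding img by auto
      qed
      then obtain y where y: "\<And>i. i < r \<Longrightarrow> y i \<in> carrier_vec r \<and> \<sigma> g *\<^sub>v col B i = B *\<^sub>v y i"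
        by metis
      define X where "X = mat_of_cols r (map y [0..<r])"
      have X: "X \<in> carrier_mat r r"
        using mat_of_cols_carrier(1)[of r "map y [0..<r]"] by (simp add: X_def)
      have colX: "col X i = y i" if "i < r" for i
        using y[OF that] that by (simp add: X_def)
      have "\<sigma> g * B = B * X"
      proof (intro mat_col_eqI)
        fix i assume "i < dim_col (B * X)"
        then have i: "i < r" using X by simp
        have "col (\<sigma> g * B) i = \<sigma> g *\<^sub>v col B i" using col_mult2[OF cm[OF g] B i] .
        also have "\<dots> = B *\<^sub>v y i" using y[OF i] by simp
        also have "\<dots> = col (B * X) i" using col_mult2[OF B X i] colX[OF i] by simp
        finally show "col (\<sigma> g * B) i = col (B * X) i" .
      qed (use cm[OF g] B X in auto)
      with X show ?thesis by blast
    qed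
    then obtain \<rho> where \<rho>: "\<And>g. g \<in> carrier G \<Longrightarrow> \<rho> g \<in> carrier_mat r r"
      and \<sigma>B: "\<And>g. g \<in> carrier G \<Longrightarrow> \<sigma> g * B = B * \<rho> g" by metis
    note cancel = mat_mult_left_cancel[OF B inj]
    have "\<rho> (g \<otimes>\<^bsub>G\<^esub> h) = \<rho> g * \<rho> h" if g: "g \<in> carrier G" and h: "h \<in> carrier G" for g h
    proof (rule cancel)
      have "B * \<rho> (g \<otimes>\<^bsub>G\<^esub> h) = \<sigma> (g \<otimes>\<^bsub>G\<^esub> h) * B" using \<sigma>B g h by simp
      also have "\<dots> = \<sigma> g * \<sigma> h * B" using less.prems(1) g h by (simp add: matrix_rep_def)
      also have "\<dots> = \<sigma> g * (B * \<rho> h)" using cm g h B \<sigma>B by (metis assoc_mult_mat)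
      also have "\<dots> = B * \<rho> g * \<rho> h" using cm[OF g] \<rho>[OF h] B \<sigma>B[OF g] by (metis assoc_mult_mat)
      also have "\<dots> = B * (\<rho> g * \<rho> h)" using \<rho>[OF g] \<rho>[OF h] B by (metis assoc_mult_mat)
      finally show "B * \<rho> (g \<otimes>\<^bsub>G\<^esub> h) = B * (\<rho> g * \<rho> h)" .
    qed (use \<rho>[of g] \<rho>[of h] \<rho>[of "g \<otimes>\<^bsub>G\<^esub> h"] g h in \<open>auto intro: mult_carrier_mat\<close>)
    moreover have "\<rho> \<one>\<^bsub>G\<^esub> = 1\<^sub>m r"
    proof (rule cancel)
      have "B * \<rho> \<one>\<^bsub>G\<^esub> = \<sigma> \<one>\<^bsub>G\<^esub> * B" using \<sigma>B by simp
      also have "\<dots> = B * 1\<^sub>m r" using less.prems(1) B by (simp add: matrix_rep_def)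
      finally show "B * \<rho> \<one>\<^bsub>G\<^esub> = B * 1\<^sub>m r" .
    qed (use \<rho> in auto)
    ultimately have rep: "matrix_rep G r \<rho>" using \<rho> by (simp add: matrix_rep_def)
    have "min_rep_dim G \<le> r"
    proof (rule less.IH[OF r(2) rep r(1)])
      \<comment> \<open>A fixed vector of the restriction is carried by \<open>B\<close> to a fixed
        vector of \<open>\<sigma>\<close>, so the absence of fixed vectors is inherited.\<close>
      fix x assume x: "x \<in> carrier_vec r" and fx: "\<And>g. g \<in> carrier G \<Longrightarrow> \<rho> g *\<^sub>v x = x"
      have "B *\<^sub>v x = 0\<^sub>v n"
      proof (rule less.prems(3))
        show "B *\<^sub>v x \<in> carrier_vec n" using B x by auto
        fix g assume g: "g \<in> carrier G"
        have "\<sigma> g *\<^sub>v (B *\<^sub>v x) = \<sigma> g * B *\<^sub>v x" using cm[OF g] B x by simp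
        also have "\<dots> = B *\<^sub>v (\<rho> g *\<^sub>v x)" using \<sigma>B[OF g] \<rho>[OF g] B x by simp
        finally show "\<sigma> g *\<^sub>v (B *\<^sub>v x) = B *\<^sub>v x" using fx[OF g] by simp
      qed
      then show "x = 0\<^sub>v r" using inj x by blast
    qed
    with r(2) show ?thesis by simp
  qed
qed

section \<open>Eigenspaces of Cayley graphs\<close>

locale finite_cayley = group G for G :: "('a, 'b) monoid_scheme" (structure) +
  fixes S :: "'a set"
  assumes fin: "finite (carrier G)"
    and S_sub: "S \<subseteq> carrier G"
    and S_inv: "s \<in> S \<Longrightarrow> inv s \<in> S"
begin

text \<open>Adding the all-ones matrix to the adjacency matrix separates the constants from every other
  eigenvector of the adjacency matrix, also when the Cayley graph is disconnected.\<close>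

definition shifted_adjacency :: "'a \<Rightarrow> 'a \<Rightarrow> real" where
  "shifted_adjacency g h = (if inv g \<otimes> h \<in> S then 1 else 0) + 1"

text \<open>The common row sum of the shifted matrix, hence its eigenvalue on the constants.\<close>

definition top_eigenvalue :: real where
  "top_eigenvalue = real (card S) + real (card (carrier G))"

lemma card_pos: "card (carrier G) > 0"
  using fin one_closed card_gt_0_iff by blast

lemma sum_translate:
  assumes "x \<in> carrier G"
  shows "(\<Sum>g\<in>carrier G. h (x \<otimes> g)) = (\<Sum>g\<in>carrier G. h g)"
proof -
  have "bij_betw (\<lambda>g. x \<otimes> g) (carrier G) (carrier G)"
    by (rule bij_betw_byWitness[where f' = "\<lambda>g. inv x \<otimes> g"])
      (use assms in \<open>auto simp: m_assoc[symmetric]\<close>)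
  then show ?thesis by (rule sum.reindex_bij_betw)
qed

lemma shifted_adjacency_sym:
  assumes "g \<in> carrier G" "h \<in> carrier G"
  shows "shifted_adjacency g h = shifted_adjacency h g"
proof -
  have "inv (inv g \<otimes> h) = inv h \<otimes> g" "inv (inv h \<otimes> g) = inv g \<otimes> h"
    using assms by (simp_all add: inv_mult_group)
  then have "inv g \<otimes> h \<in> S \<longleftrightarrow> inv h \<otimes> g \<in> S" using S_inv by metis
  then show ?thesis by (simp add: shifted_adjacency_def)
qed

text \<open>Edges come from right multiplication, so the matrix commutes with left
  translations.\<close>

lemma shifted_adjacency_translate:
  assumes "x \<in> carrier G" "g \<in> carrier G" "h \<in> carrier G"
  shows "shifted_adjacency g (x \<otimes> h) = shifted_adjacency (inv x \<otimes> g) h"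
proof -
  have "inv (inv x \<otimes> g) \<otimes> h = inv g \<otimes> (x \<otimes> h)"
    using assms by (simp add: inv_mult_group m_assoc)
  then show ?thesis by (simp add: shifted_adjacency_def)
qed

lemma shifted_adjacency_apply:
  assumes g: "g \<in> carrier G"
  shows "(\<Sum>h\<in>carrier G. shifted_adjacency g h * v h) = (\<Sum>s\<in>S. v (g \<otimes> s)) + (\<Sum>h\<in>carrier G. v h)"
proof -
  have "(\<Sum>h\<in>carrier G. (if inv g \<otimes> h \<in> S then 1 else 0) * v h) =
      (\<Sum>h\<in>carrier G. (if inv g \<otimes> (g \<otimes> h) \<in> S then 1 else 0) * v (g \<otimes> h))"
    by (rule sum_translate[OF g, symmetric])
  also have "\<dots> = (\<Sum>h\<in>carrier G. if h \<in> S then v (g \<otimes> h) else 0)"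
    by (intro sum.cong refl) (use g in \<open>simp add: m_assoc[symmetric]\<close>)
  also have "\<dots> = (\<Sum>s\<in>carrier G \<inter> S. v (g \<otimes> s))"
    using fin by (simp add: sum.inter_restrict)
  also have "carrier G \<inter> S = S" using S_sub by auto
  finally show ?thesis by (simp add: shifted_adjacency_def distrib_right sum.distrib)
qed

lemma shifted_adjacency_row_sum:
  assumes "g \<in> carrier G"
  shows "(\<Sum>h\<in>carrier G. shifted_adjacency g h) = top_eigenvalue"
  using shifted_adjacency_apply[OF assms, of "\<lambda>_. 1"] by (simp add: top_eigenvalue_def)

text \<open>Maximum principle: at a maximum \<open>m\<close> of \<open>v\<close> the eigenvalue
  equation forces the sum of all \<open>v m - v x\<close> to be at most 0, while every summand is
  nonnegative. The all-ones part compares \<open>m\<close> with the whole group, not only with its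
  neighbours.\<close>

lemma top_eigenvector_constant:
  assumes eig: "\<And>g. g \<in> carrier G \<Longrightarrow> (\<Sum>h\<in>carrier G. shifted_adjacency g h * v h) = top_eigenvalue * v g"
    and g: "g \<in> carrier G" and h: "h \<in> carrier G"
  shows "v g = v h"
proof -
  have "finite (v ` carrier G)" "v ` carrier G \<noteq> {}" using fin g by auto
  then have "Max (v ` carrier G) \<in> v ` carrier G" by (rule Max_in)
  then obtain m where m: "m \<in> carrier G" "v m = Max (v ` carrier G)" by auto
  have le: "v x \<le> v m" if "x \<in> carrier G" for x
    unfolding m(2) using fin that by (intro Max_ge) auto
  have "top_eigenvalue * v m = (\<Sum>s\<in>S. v (m \<otimes> s)) + (\<Sum>x\<in>carrier G. v x)"
    using eig[OF m(1)] shifted_adjacency_apply[OF m(1), of v] by simp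
  also have "(\<Sum>s\<in>S. v (m \<otimes> s)) \<le> (\<Sum>s\<in>S. v m)"
    by (intro sum_mono le) (use m(1) S_sub in auto)
  finally have "(\<Sum>x\<in>carrier G. v m - v x) \<le> 0"
    by (simp add: top_eigenvalue_def sum_subtractf algebra_simps)
  moreover have nn: "0 \<le> v m - v x" if "x \<in> carrier G" for x using le[OF that] by simp
  ultimately have "(\<Sum>x\<in>carrier G. v m - v x) = 0"
    by (intro antisym sum_nonneg) auto
  moreover have "(\<Sum>x\<in>carrier G. v m - v x) = 0 \<longleftrightarrow> (\<forall>x\<in>carrier G. v m - v x = 0)"
    by (rule sum_nonneg_eq_0_iff[OF fin nn])
  ultimately have "v m - v g = 0" "v m - v h = 0" using g h by blast+
  then show ?thesis by linarith
qed

end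

section \<open>The left regular representation on the eigenspaces\<close>

locale cayley_eigenbasis = finite_cayley +
  fixes U :: "'a \<Rightarrow> 'a \<Rightarrow> real" and \<mu> :: "'a \<Rightarrow> real"
  assumes U: "orth (carrier G) U"
    and eig: "\<lbrakk>j \<in> carrier G; g \<in> carrier G\<rbrakk> \<Longrightarrow> (\<Sum>h\<in>carrier G. shifted_adjacency g h * U j h) = \<mu> j * U j g"
begin

text \<open>An eigenspace is encoded by the indices of its basis vectors, so its dimension is a
  cardinality and orthogonal matrices can be indexed by it.\<close>

definition eigenspace :: "real \<Rightarrow> 'a set" where
  "eigenspace c = {k \<in> carrier G. \<mu> k = c}"

text \<open>Matrix coefficient of the left regular representation in the basis \<open>U\<close>: the
  inner product of \<open>U j\<close> with the translate of \<open>U k\<close> by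
  \<open>x\<close>.\<close>

definition rep :: "'a \<Rightarrow> 'a \<Rightarrow> 'a \<Rightarrow> real" where
  "rep x j k = (\<Sum>g\<in>carrier G. U j g * U k (inv x \<otimes> g))"

lemma eigenspace_sub: "k \<in> eigenspace c \<Longrightarrow> k \<in> carrier G" "k \<in> eigenspace c \<Longrightarrow> \<mu> k = c"
  by (auto simp: eigenspace_def)

lemma finite_eigenspace: "finite (eigenspace c)"
  using fin by (simp add: eigenspace_def)

text \<open>Eigenvectors of a symmetric matrix for different eigenvalues are orthogonal, and the
  constants belong to the top eigenvalue.\<close>

lemma eigenspace_sum_zero:
  assumes c: "c \<noteq> top_eigenvalue" and k: "k \<in> eigenspace c"
  shows "(\<Sum>g\<in>carrier G. U k g) = 0"
proof -
  have "c * (\<Sum>g\<in>carrier G. U k g) = (\<Sum>g\<in>carrier G. \<Sum>h\<in>carrier G. shifted_adjacency g h * U k h)"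
    unfolding sum_distrib_left by (intro sum.cong refl) (use eig eigenspace_sub[OF k] in auto)
  also have "\<dots> = (\<Sum>h\<in>carrier G. \<Sum>g\<in>carrier G. shifted_adjacency g h * U k h)" by (rule sum.swap)
  also have "\<dots> = (\<Sum>h\<in>carrier G. (\<Sum>g\<in>carrier G. shifted_adjacency h g) * U k h)"
    unfolding sum_distrib_right by (intro sum.cong refl) (simp add: shifted_adjacency_sym)
  also have "\<dots> = top_eigenvalue * (\<Sum>h\<in>carrier G. U k h)"
    unfolding sum_distrib_left by (intro sum.cong refl) (simp add: shifted_adjacency_row_sum)
  finally show ?thesis using c by simp
qed

text \<open>A translate of \<open>U k\<close> is again an eigenvector for \<open>\<mu> k\<close>,
  hence orthogonal to \<open>U j\<close>. So \<open>rep x\<close> is block diagonal along the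
  eigenspaces.\<close>

lemma rep_off_diagonal:
  assumes x: "x \<in> carrier G" and j: "j \<in> carrier G" and k: "k \<in> carrier G" and "\<mu> j \<noteq> \<mu> k"
  shows "rep x j k = 0"
proof -
  have inner: "(\<Sum>g\<in>carrier G. shifted_adjacency h g * U k (inv x \<otimes> g)) = \<mu> k * U k (inv x \<otimes> h)" if h: "h \<in> carrier G" for h
  proof -
    have "(\<Sum>g\<in>carrier G. shifted_adjacency h g * U k (inv x \<otimes> g)) = (\<Sum>g\<in>carrier G. shifted_adjacency h (x \<otimes> g) * U k (inv x \<otimes> (x \<otimes> g)))"
      by (rule sum_translate[OF x, symmetric])
    also have "\<dots> = (\<Sum>g\<in>carrier G. shifted_adjacency (inv x \<otimes> h) g * U k g)"
      by (intro sum.cong refl) (use x h in \<open>simp add: shifted_adjacency_translate m_assoc[symmetric]\<close>)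
    also have "\<dots> = \<mu> k * U k (inv x \<otimes> h)" using eig x h k by simp
    finally show ?thesis .
  qed
  have "\<mu> j * rep x j k = (\<Sum>g\<in>carrier G. (\<Sum>h\<in>carrier G. shifted_adjacency g h * U j h) * U k (inv x \<otimes> g))"
    unfolding rep_def sum_distrib_left by (intro sum.cong refl) (use eig j in auto)
  also have "\<dots> = (\<Sum>h\<in>carrier G. \<Sum>g\<in>carrier G. shifted_adjacency g h * U j h * U k (inv x \<otimes> g))"
    unfolding sum_distrib_right by (rule sum.swap)
  also have "\<dots> = (\<Sum>h\<in>carrier G. U j h * (\<Sum>g\<in>carrier G. shifted_adjacency h g * U k (inv x \<otimes> g)))"
    unfolding sum_distrib_left by (intro sum.cong refl) (simp add: shifted_adjacency_sym)
  also have "\<dots> = (\<Sum>h\<in>carrier G. U j h * (\<mu> k * U k (inv x \<otimes> h)))"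
    by (intro sum.cong refl) (simp add: inner)
  also have "\<dots> = \<mu> k * rep x j k"
    unfolding rep_def sum_distrib_left by (intro sum.cong refl) simp
  finally show ?thesis using \<open>\<mu> j \<noteq> \<mu> k\<close> by simp
qed

lemma translate_expand:
  assumes x: "x \<in> carrier G" and g: "g \<in> carrier G" and k: "k \<in> eigenspace c"
  shows "U k (inv x \<otimes> g) = (\<Sum>l\<in>eigenspace c. rep x l k * U l g)"
proof -
  have "U k (inv x \<otimes> g) = (\<Sum>l\<in>carrier G. rep x l k * U l g)"
    unfolding rep_def using orth_expand[OF fin U g, of "\<lambda>a. U k (inv x \<otimes> a)"] by simp
  also have "\<dots> = (\<Sum>l\<in>eigenspace c. rep x l k * U l g)"
    by (intro sum.mono_neutral_right fin)
      (use x k rep_off_diagonal in \<open>auto simp: eigenspace_def\<close>)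
  finally show ?thesis .
qed

lemma rep_mult:
  assumes x: "x \<in> carrier G" and y: "y \<in> carrier G" and k: "k \<in> eigenspace c"
  shows "rep (x \<otimes> y) j k = (\<Sum>l\<in>eigenspace c. rep x j l * rep y l k)"
proof -
  have "rep (x \<otimes> y) j k = (\<Sum>g\<in>carrier G. U j g * U k (inv y \<otimes> (inv x \<otimes> g)))"
    unfolding rep_def by (intro sum.cong refl) (use x y in \<open>simp add: inv_mult_group m_assoc\<close>)
  also have "\<dots> = (\<Sum>g\<in>carrier G. \<Sum>l\<in>eigenspace c. U j g * (rep y l k * U l (inv x \<otimes> g)))"
    unfolding sum_distrib_left[symmetric]
    by (intro sum.cong refl) (use x y k translate_expand[OF y _ k] in simp)
  also have "\<dots> = (\<Sum>l\<in>eigenspace c. \<Sum>g\<in>carrier G. U j g * (rep y l k * U l (inv x \<otimes> g)))"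
    by (rule sum.swap)
  also have "\<dots> = (\<Sum>l\<in>eigenspace c. rep x j l * rep y l k)"
    unfolding rep_def[of x] sum_distrib_right by (simp add: mult_ac)
  finally show ?thesis .
qed

lemma rep_one:
  assumes "j \<in> carrier G" "k \<in> carrier G"
  shows "rep \<one> j k = (if j = k then 1 else 0)"
  unfolding rep_def using orth_row[OF U assms] by simp

lemma rep_inv:
  assumes x: "x \<in> carrier G"
  shows "rep (inv x) j k = rep x k j"
proof -
  have "rep (inv x) j k = (\<Sum>g\<in>carrier G. U j g * U k (x \<otimes> g))"
    unfolding rep_def using x by simp
  also have "\<dots> = (\<Sum>g\<in>carrier G. U j (inv x \<otimes> g) * U k (x \<otimes> (inv x \<otimes> g)))"
    using sum_translate[of "inv x" "\<lambda>g. U j g * U k (x \<otimes> g)"] x by simp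
  also have "\<dots> = rep x k j"
    unfolding rep_def by (intro sum.cong refl) (use x in \<open>simp add: m_assoc[symmetric]\<close>)
  finally show ?thesis .
qed

text \<open>The sum of squares is unchanged by left translation because \<open>rep x\<close> is
  orthogonal on the eigenspace. It is thus constant on the group, and summing over the group
  determines the constant.\<close>

lemma eigenspace_diagonal:
  assumes g: "g \<in> carrier G"
  shows "(\<Sum>k\<in>eigenspace c. (U k g)\<^sup>2) = real (card (eigenspace c)) / real (card (carrier G))"
proof -
  let ?E = "eigenspace c"
  define K where "K g = (\<Sum>k\<in>?E. (U k g)\<^sup>2)" for g
  have rr: "(\<Sum>k\<in>?E. rep x l k * rep x m k) = (if l = m then 1 else 0)"
    if "x \<in> carrier G" "l \<in> ?E" "m \<in> ?E" for x l m
  proof -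
    have "(\<Sum>k\<in>?E. rep x l k * rep x m k) = (\<Sum>k\<in>?E. rep x l k * rep (inv x) k m)"
      using that(1) by (simp add: rep_inv)
    also have "\<dots> = rep (x \<otimes> inv x) l m"
      using rep_mult[OF that(1) inv_closed[OF that(1)] that(3)] by simp
    also have "\<dots> = (if l = m then 1 else 0)" using that rep_one eigenspace_sub(1) by simp
    finally show ?thesis .
  qed
  have inv: "K (inv x \<otimes> g) = K g" if x: "x \<in> carrier G" and g: "g \<in> carrier G" for x g
  proof -
    have "K (inv x \<otimes> g) = (\<Sum>k\<in>?E. \<Sum>l\<in>?E. \<Sum>m\<in>?E. (rep x l k * U l g) * (rep x m k * U m g))"
      unfolding K_def power2_eq_square sum_product[symmetric]
      by (intro sum.cong refl) (simp add: translate_expand[OF x g])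
    also have "\<dots> = (\<Sum>l\<in>?E. \<Sum>k\<in>?E. \<Sum>m\<in>?E. (rep x l k * U l g) * (rep x m k * U m g))"
      by (rule sum.swap)
    also have "\<dots> = (\<Sum>l\<in>?E. \<Sum>m\<in>?E. \<Sum>k\<in>?E. (rep x l k * U l g) * (rep x m k * U m g))"
      by (intro sum.cong refl sum.swap)
    also have "\<dots> = (\<Sum>l\<in>?E. \<Sum>m\<in>?E. (\<Sum>k\<in>?E. rep x l k * rep x m k) * (U l g * U m g))"
      unfolding sum_distrib_right by (simp add: mult_ac)
    also have "\<dots> = (\<Sum>l\<in>?E. \<Sum>m\<in>?E. if m = l then (U l g)\<^sup>2 else 0)"
      by (intro sum.cong refl) (simp add: rr[OF x] power2_eq_square)
    also have "\<dots> = K g" unfolding K_def using finite_eigenspace[of c] by simp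
    finally show ?thesis .
  qed
  \<comment> \<open>Invariance is used with both the translation and the point equal to
    \<open>h\<close>.\<close>
  have const: "K h = K \<one>" if "h \<in> carrier G" for h
    using inv[OF that that] that by simp
  have "(\<Sum>h\<in>carrier G. K h) = (\<Sum>k\<in>?E. \<Sum>h\<in>carrier G. U k h * U k h)"
    unfolding K_def power2_eq_square by (rule sum.swap)
  also have "\<dots> = real (card ?E)"
    using orth_row[OF U] eigenspace_sub(1) by simp
  finally have "real (card (carrier G)) * K \<one> = real (card ?E)"
    by (simp add: sum.cong[OF refl const])
  then have "K g = real (card ?E) / real (card (carrier G))"
    using const[OF g] card_pos by (simp add: field_simps)
  then show ?thesis by (simp add: K_def)
qed

text \<open>The group acts on the eigenspace through \<open>rep\<close>. A fixed vector would be a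
  left invariant function, hence constant, but the eigenspace is orthogonal to the
  constants.\<close>

lemma min_rep_dim_le_eigenspace:
  assumes c: "c \<noteq> top_eigenvalue" and ne: "eigenspace c \<noteq> {}"
  shows "min_rep_dim G \<le> card (eigenspace c)"
proof -
  let ?E = "eigenspace c"
  define n where "n = card ?E"
  obtain f where f: "bij_betw f {0..<n} ?E"
    unfolding n_def using ex_bij_betw_nat_finite[OF finite_eigenspace] by blast
  have fE: "f a \<in> ?E" if "a < n" for a using bij_betwE[OF f] that by auto
  have finj: "f a = f b \<longleftrightarrow> a = b" if "a < n" "b < n" for a b
    using f that by (auto simp: bij_betw_def inj_on_def)
  define \<sigma> where "\<sigma> x = mat n n (\<lambda>(a, b). complex_of_real (rep x (f a) (f b)))" for x
  have "matrix_rep G n \<sigma>"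
    unfolding matrix_rep_def
  proof (intro conjI ballI)
    fix x y assume xy: "x \<in> carrier G" "y \<in> carrier G"
    show "\<sigma> (x \<otimes> y) = \<sigma> x * \<sigma> y"
    proof (rule eq_matI)
      fix a b assume "a < dim_row (\<sigma> x * \<sigma> y)" "b < dim_col (\<sigma> x * \<sigma> y)"
      then have ab: "a < n" "b < n" by (simp_all add: \<sigma>_def)
      have "rep (x \<otimes> y) (f a) (f b) = (\<Sum>l\<in>?E. rep x (f a) l * rep y l (f b))"
        using rep_mult xy fE ab by blast
      also have "\<dots> = (\<Sum>i\<in>{0..<n}. rep x (f a) (f i) * rep y (f i) (f b))"
        by (rule sum.reindex_bij_betw[OF f, symmetric])
      finally show "\<sigma> (x \<otimes> y) $$ (a, b) = (\<sigma> x * \<sigma> y) $$ (a, b)"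
        using ab by (simp add: \<sigma>_def scalar_prod_def)
    qed (simp_all add: \<sigma>_def)
  next
    have "rep \<one> (f a) (f b) = (if a = b then 1 else 0)" if "a < n" "b < n" for a b
      using that rep_one[of "f a" "f b"] eigenspace_sub(1)[OF fE] finj by simp
    then show "\<sigma> \<one> = 1\<^sub>m n"
      by (intro eq_matI) (auto simp: \<sigma>_def)
  qed (simp add: \<sigma>_def)
  moreover have "n > 0" using ne finite_eigenspace by (simp add: n_def card_gt_0_iff)
  moreover have "x = 0\<^sub>v n" if x: "x \<in> carrier_vec n" and fx: "\<And>g. g \<in> carrier G \<Longrightarrow> \<sigma> g *\<^sub>v x = x" for x
  proof -
    \<comment> \<open>The function with coordinates \<open>x\<close> in the eigenspace;
      \<open>x\<close> being fixed makes it left invariant.\<close>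
    define v where "v y = (\<Sum>a\<in>{0..<n}. x $ a * complex_of_real (U (f a) y))" for y
    have vinv: "v (inv g \<otimes> y) = v y" if g: "g \<in> carrier G" and y: "y \<in> carrier G" for g y
    proof -
      have "v (inv g \<otimes> y) = (\<Sum>a\<in>{0..<n}. \<Sum>b\<in>{0..<n}. x $ a * complex_of_real (rep g (f b) (f a) * U (f b) y))"
        unfolding v_def sum_distrib_left[symmetric]
      proof (intro sum.cong refl)
        fix a assume "a \<in> {0..<n}"
        then have "f a \<in> ?E" using fE by simp
        then have "U (f a) (inv g \<otimes> y) = (\<Sum>l\<in>?E. rep g l (f a) * U l y)"
          by (rule translate_expand[OF g y])
        also have "\<dots> = (\<Sum>b\<in>{0..<n}. rep g (f b) (f a) * U (f b) y)"
          by (rule sum.reindex_bij_betw[OF f, symmetric])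
        finally show "x $ a * complex_of_real (U (f a) (inv g \<otimes> y)) =
            x $ a * (\<Sum>b\<in>{0..<n}. complex_of_real (rep g (f b) (f a) * U (f b) y))"
          by (simp add: of_real_sum)
      qed
      also have "\<dots> = (\<Sum>b\<in>{0..<n}. (\<Sum>a\<in>{0..<n}. complex_of_real (rep g (f b) (f a)) * x $ a) * complex_of_real (U (f b) y))"
        by (subst sum.swap) (simp add: sum_distrib_left sum_distrib_right mult_ac)
      also have "\<dots> = (\<Sum>b\<in>{0..<n}. (\<sigma> g *\<^sub>v x) $ b * complex_of_real (U (f b) y))"
        by (intro sum.cong refl) (use x in \<open>simp add: \<sigma>_def scalar_prod_def\<close>)
      also have "\<dots> = v y" by (simp add: fx[OF g] v_def)
      finally show ?thesis .
    qed
    have vconst: "v y = v \<one>" if "y \<in> carrier G" for y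
      using vinv[OF that that] that by simp
    \<comment> \<open>The coordinate is the inner product of the constant function \<open>v\<close>
      with a basis function of sum zero.\<close>
    have "x $ b = 0" if b: "b < n" for b
    proof -
      have "(\<Sum>y\<in>carrier G. v y * complex_of_real (U (f b) y)) =
          (\<Sum>a\<in>{0..<n}. x $ a * complex_of_real (\<Sum>y\<in>carrier G. U (f a) y * U (f b) y))"
        unfolding v_def sum_distrib_right sum_distrib_left of_real_sum
        by (subst sum.swap) (simp add: mult_ac)
      also have "\<dots> = (\<Sum>a\<in>{0..<n}. if a = b then x $ a else 0)"
      proof (intro sum.cong refl)
        fix a assume "a \<in> {0..<n}"
        then have "(\<Sum>y\<in>carrier G. U (f a) y * U (f b) y) = (if a = b then 1 else 0)"
          using orth_row[OF U eigenspace_sub(1)[OF fE] eigenspace_sub(1)[OF fE]] finj b by simp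
        then show "x $ a * complex_of_real (\<Sum>y\<in>carrier G. U (f a) y * U (f b) y) = (if a = b then x $ a else 0)"
          by simp
      qed
      also have "\<dots> = x $ b" using b by simp
      finally have "x $ b = (\<Sum>y\<in>carrier G. v y * complex_of_real (U (f b) y))" by simp
      also have "\<dots> = v \<one> * complex_of_real (\<Sum>y\<in>carrier G. U (f b) y)"
        unfolding of_real_sum sum_distrib_left by (intro sum.cong arg_cong2[where f = "(*)"] refl vconst)
      also have "\<dots> = 0" using eigenspace_sum_zero[OF c] fE[OF b] by simp
      finally show ?thesis .
    qed
    then show ?thesis using x by (intro eq_vecI) auto
  qed
  ultimately show ?thesis
    unfolding n_def[symmetric] using min_rep_dim_le[OF is_group] by blast
qed

section \<open>Compressions of multiplication operators to eigenspaces\<close>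

text \<open>The matrix of multiplication by \<open>h\<close> in the basis \<open>U\<close>; with
  both indices in one eigenspace it is the compression to that eigenspace.\<close>

definition mult_form :: "('a \<Rightarrow> real) \<Rightarrow> 'a \<Rightarrow> 'a \<Rightarrow> real" where
  "mult_form h a b = (\<Sum>g\<in>carrier G. h g * (U a g * U b g))"

lemma mult_form_trace:
  assumes "(\<Sum>g\<in>carrier G. h g) = 0"
  shows "(\<Sum>a\<in>eigenspace c. mult_form h a a) = 0"
proof -
  have "(\<Sum>a\<in>eigenspace c. mult_form h a a) = (\<Sum>g\<in>carrier G. h g * (\<Sum>a\<in>eigenspace c. (U a g)\<^sup>2))"
    unfolding mult_form_def sum_distrib_left power2_eq_square by (rule sum.swap)
  also have "\<dots> = (\<Sum>g\<in>carrier G. h g) * (real (card (eigenspace c)) / real (card (carrier G)))"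
    unfolding sum_distrib_right by (intro sum.cong refl) (simp add: eigenspace_diagonal)
  finally show ?thesis using assms by simp
qed

text \<open>Letting \<open>b\<close> run over the whole group only enlarges the sum, and Parseval
  turns it into the squared norm of \<open>h\<close> times \<open>U a\<close>. Summing over
  \<open>a\<close> brings in the constant diagonal of the eigenspace.\<close>

lemma mult_form_square_sum:
  "(\<Sum>a\<in>eigenspace c. \<Sum>b\<in>eigenspace c. (mult_form h a b)\<^sup>2) \<le>
    real (card (eigenspace c)) * ((\<Sum>g\<in>carrier G. (h g)\<^sup>2) / real (card (carrier G)))"
proof -
  have "(\<Sum>a\<in>eigenspace c. \<Sum>b\<in>eigenspace c. (mult_form h a b)\<^sup>2) \<le>
      (\<Sum>a\<in>eigenspace c. \<Sum>g\<in>carrier G. (h g)\<^sup>2 * (U a g)\<^sup>2)"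
  proof (intro sum_mono)
    fix a
    have "(\<Sum>b\<in>eigenspace c. (mult_form h a b)\<^sup>2) \<le> (\<Sum>b\<in>carrier G. (mult_form h a b)\<^sup>2)"
      using fin by (intro sum_mono2) (auto simp: eigenspace_def)
    also have "\<dots> = (\<Sum>b\<in>carrier G. (\<Sum>g\<in>carrier G. U b g * (h g * U a g)) * (\<Sum>g\<in>carrier G. U b g * (h g * U a g)))"
      unfolding mult_form_def power2_eq_square by (simp add: mult_ac)
    also have "\<dots> = (\<Sum>g\<in>carrier G. (h g)\<^sup>2 * (U a g)\<^sup>2)"
      unfolding orth_parseval[OF fin U] by (simp add: power2_eq_square mult_ac)
    finally show "(\<Sum>b\<in>eigenspace c. (mult_form h a b)\<^sup>2) \<le> (\<Sum>g\<in>carrier G. (h g)\<^sup>2 * (U a g)\<^sup>2)" .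
  qed
  also have "\<dots> = (\<Sum>g\<in>carrier G. (h g)\<^sup>2 * (\<Sum>a\<in>eigenspace c. (U a g)\<^sup>2))"
    unfolding sum_distrib_left by (rule sum.swap)
  also have "\<dots> = (\<Sum>g\<in>carrier G. (h g)\<^sup>2) * (real (card (eigenspace c)) / real (card (carrier G)))"
    unfolding sum_distrib_right by (intro sum.cong refl) (simp add: eigenspace_diagonal)
  finally show ?thesis by (simp add: mult.commute)
qed

text \<open>Dividing the compressions by \<open>\<tau> i\<close> normalises their Hilbert-Schmidt
  norms as \<open>flat_orthonormal_basis\<close> requires; the factor is restored
  afterwards.\<close>

lemma flat_eigenspace_basis:
  fixes h :: "nat \<Rightarrow> 'a \<Rightarrow> real"
  assumes mean: "\<And>i. i \<in> {1..M} \<Longrightarrow> (\<Sum>g\<in>carrier G. h i g) = 0"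
  shows "\<exists>V. orth (eigenspace c) V \<and> (\<forall>i\<in>{1..M}. \<forall>j\<in>eigenspace c.
    \<bar>bil (eigenspace c) (mult_form (h i)) (V j) (V j)\<bar> \<le>
      sqrt ((\<Sum>g\<in>carrier G. (h i g)\<^sup>2) / real (card (carrier G))) *
      (sqrt (32 / real (card (eigenspace c))) * ln (24 * real M * real (card (eigenspace c)))))"
proof (cases "eigenspace c = {}")
  case True
  have "\<exists>V. orth (eigenspace c) V" using orth_id[OF finite_eigenspace] by blast
  with True show ?thesis by simp
next
  case False
  let ?E = "eigenspace c"
  define \<tau> where "\<tau> i = sqrt ((\<Sum>g\<in>carrier G. (h i g)\<^sup>2) / real (card (carrier G)))" for i
  define q where "q i a b = mult_form (h i) a b / \<tau> i" for i a b
  have \<tau>0: "\<tau> i \<ge> 0" for i by (simp add: \<tau>_def sum_nonneg)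
  have \<tau>sq: "(\<tau> i)\<^sup>2 = (\<Sum>g\<in>carrier G. (h i g)\<^sup>2) / real (card (carrier G))" for i
    by (simp add: \<tau>_def sum_nonneg)
  have hs: "(\<Sum>a\<in>?E. \<Sum>b\<in>?E. (mult_form (h i) a b)\<^sup>2) \<le> real (card ?E) * (\<tau> i)\<^sup>2" for i
    unfolding \<tau>sq by (rule mult_form_square_sum)
  have q_hs: "(\<Sum>a\<in>?E. \<Sum>b\<in>?E. (q i a b)\<^sup>2) \<le> real (card ?E)" for i
  proof (cases "\<tau> i = 0")
    case False
    have "(\<Sum>a\<in>?E. \<Sum>b\<in>?E. (q i a b)\<^sup>2) = (\<Sum>a\<in>?E. \<Sum>b\<in>?E. (mult_form (h i) a b)\<^sup>2) / (\<tau> i)\<^sup>2"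
      by (simp add: q_def power_divide sum_divide_distrib)
    also have "\<dots> \<le> real (card ?E)" using hs[of i] False by (simp add: divide_le_eq)
    finally show ?thesis .
  qed (simp add: q_def)
  obtain V where V: "orth ?E V" and bound: "\<And>i j. i \<in> {1..M} \<Longrightarrow> j \<in> ?E \<Longrightarrow>
      \<bar>bil ?E (q i) (V j) (V j)\<bar> \<le> sqrt (32 / real (card ?E)) * ln (24 * real M * real (card ?E))"
  proof -
    have "(\<Sum>a\<in>?E. q i a a) = 0" if "i \<in> {1..M}" for i
      using mult_form_trace[OF mean[OF that]] by (simp add: q_def sum_divide_distrib[symmetric])
    moreover have "q i a b = q i b a" for i a b by (simp add: q_def mult_form_def mult.commute[of "U a _"])
    ultimately show ?thesis
      using that flat_orthonormal_basis[OF finite_eigenspace False, where q = q and M = M] q_hs by blast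
  qed
  have "\<bar>bil ?E (mult_form (h i)) (V j) (V j)\<bar> = \<tau> i * \<bar>bil ?E (q i) (V j) (V j)\<bar>" if "j \<in> ?E" for i j
  proof (cases "\<tau> i = 0")
    \<comment> \<open>Both sides vanish: by \<open>hs\<close> the compression has Hilbert-Schmidt
      norm zero, so nothing is lost when division by zero makes \<open>q i\<close> zero.\<close>
    case True
    have "(\<Sum>a\<in>?E. \<Sum>b\<in>?E. (mult_form (h i) a b)\<^sup>2) = 0"
      using hs[of i] True by (intro antisym sum_nonneg) auto
    then have "mult_form (h i) a b = 0" if "a \<in> ?E" "b \<in> ?E" for a b
      using that finite_eigenspace[of c] by (simp add: sum_nonneg_eq_0_iff sum_nonneg)
    then show ?thesis using True by (simp add: bil_def)
  next
    case False
    have "bil ?E (mult_form (h i)) (V j) (V j) = \<tau> i * bil ?E (q i) (V j) (V j)"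
      unfolding bil_def sum_distrib_left by (intro sum.cong refl) (use False in \<open>simp add: q_def\<close>)
    then show ?thesis using \<tau>0 by (simp add: abs_mult)
  qed
  then have "\<bar>bil ?E (mult_form (h i)) (V j) (V j)\<bar> \<le>
      \<tau> i * (sqrt (32 / real (card ?E)) * ln (24 * real M * real (card ?E)))" if "i \<in> {1..M}" "j \<in> ?E" for i j
    using that bound \<tau>0 by (simp add: mult_left_mono)
  with V show ?thesis unfolding \<tau>_def by blast
qed

end

context cayley_eigenbasis
begin

lemma quadratic_form_eq:
  assumes V: "orth (eigenspace c) V"
  shows "(\<Sum>g\<in>carrier G. h g * (\<Sum>k\<in>carrier G. V j k * U k g)\<^sup>2) = bil (eigenspace c) (mult_form h) (V j) (V j)"
proof -
  let ?E = "eigenspace c"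
  have "(\<Sum>k\<in>carrier G. V j k * U k g) = (\<Sum>k\<in>?E. V j k * U k g)" for g
    by (intro sum.mono_neutral_right fin) (use orth_outside[OF V] in \<open>auto simp: eigenspace_def\<close>)
  then have "(\<Sum>g\<in>carrier G. h g * (\<Sum>k\<in>carrier G. V j k * U k g)\<^sup>2) =
      (\<Sum>g\<in>carrier G. \<Sum>a\<in>?E. \<Sum>b\<in>?E. V j a * (h g * (U a g * U b g)) * V j b)"
    by (simp add: power2_eq_square sum_product sum_distrib_left mult_ac)
  also have "\<dots> = (\<Sum>a\<in>?E. \<Sum>g\<in>carrier G. \<Sum>b\<in>?E. V j a * (h g * (U a g * U b g)) * V j b)"
    by (rule sum.swap)
  also have "\<dots> = (\<Sum>a\<in>?E. \<Sum>b\<in>?E. \<Sum>g\<in>carrier G. V j a * (h g * (U a g * U b g)) * V j b)"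
    by (intro sum.cong refl sum.swap)
  also have "\<dots> = bil ?E (mult_form h) (V j) (V j)"
    by (simp add: bil_def mult_form_def sum_distrib_left sum_distrib_right)
  finally show ?thesis .
qed

end

context finite_cayley
begin

text \<open>Each eigenspace receives a flat basis. The first alternative comes from the top
  eigenvalue, where basis functions are constant and \<open>h i\<close> has mean zero; in the
  second, \<open>n\<close> is the dimension of another eigenspace.\<close>

lemma flat_real_eigenbasis:
  fixes h :: "nat \<Rightarrow> 'a \<Rightarrow> real"
  assumes mean: "\<And>i. i \<in> {1..M} \<Longrightarrow> (\<Sum>g\<in>carrier G. h i g) = 0"
  shows "\<exists>w. orth (carrier G) w \<and>
    (\<forall>j\<in>carrier G. \<exists>c. \<forall>g\<in>carrier G. (\<Sum>s\<in>S. w j (g \<otimes> s)) = c * w j g) \<and>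
    (\<forall>j\<in>carrier G. \<forall>i\<in>{1..M}. (\<Sum>g\<in>carrier G. h i g * (w j g)\<^sup>2) = 0 \<or>
      (\<exists>n. min_rep_dim G \<le> n \<and> n \<le> card (carrier G) \<and> n > 0 \<and>
        \<bar>\<Sum>g\<in>carrier G. h i g * (w j g)\<^sup>2\<bar> \<le>
          sqrt ((\<Sum>g\<in>carrier G. (h i g)\<^sup>2) / real (card (carrier G))) *
          (sqrt (32 / real n) * ln (24 * real M * real n))))"
proof -
  obtain U \<mu> where U: "orth (carrier G) U"
    and eig: "\<And>j g. j \<in> carrier G \<Longrightarrow> g \<in> carrier G \<Longrightarrow> (\<Sum>h\<in>carrier G. shifted_adjacency g h * U j h) = \<mu> j * U j g"
    using symmetric_diagonalisation[where I = "carrier G" and T = shifted_adjacency, OF fin shifted_adjacency_sym] by blast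
  interpret cayley_eigenbasis G S U \<mu> by unfold_locales (use U eig in auto)
  have "\<exists>V. orth (eigenspace c) V \<and> (\<forall>i\<in>{1..M}. \<forall>j\<in>eigenspace c.
    \<bar>bil (eigenspace c) (mult_form (h i)) (V j) (V j)\<bar> \<le>
      sqrt ((\<Sum>g\<in>carrier G. (h i g)\<^sup>2) / real (card (carrier G))) *
      (sqrt (32 / real (card (eigenspace c))) * ln (24 * real M * real (card (eigenspace c)))))" for c
    by (rule flat_eigenspace_basis) (rule mean)
  then obtain V where V: "\<And>c. orth (eigenspace c) (V c)" and
    bound: "\<And>c i j. i \<in> {1..M} \<Longrightarrow> j \<in> eigenspace c \<Longrightarrow>
    \<bar>bil (eigenspace c) (mult_form (h i)) (V c j) (V c j)\<bar> \<le>
      sqrt ((\<Sum>g\<in>carrier G. (h i g)\<^sup>2) / real (card (carrier G))) *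
      (sqrt (32 / real (card (eigenspace c))) * ln (24 * real M * real (card (eigenspace c))))"
    by metis
  \<comment> \<open>Row \<open>j\<close> of the new basis uses the matrix of the eigenspace
    containing \<open>j\<close>, which vanishes off that eigenspace, so the eigenvalue is still
    \<open>\<mu> j\<close>.\<close>
  define w where "w j g = (\<Sum>k\<in>carrier G. V (\<mu> j) j k * U k g)" for j g
  have w: "orth (carrier G) w"
    unfolding w_def using orth_mult[OF fin orth_block[OF fin] U] V unfolding eigenspace_def by blast
  have Vout: "V c j k = 0" if "\<mu> k \<noteq> c" for c j k
    using orth_outside[OF V, of j c k] eigenspace_sub(2) that by blast
  have Tw: "(\<Sum>x\<in>carrier G. shifted_adjacency g x * w j x) = \<mu> j * w j g" if g: "g \<in> carrier G" for j g
  proof -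
    have "(\<Sum>x\<in>carrier G. shifted_adjacency g x * w j x) = (\<Sum>k\<in>carrier G. \<Sum>x\<in>carrier G. V (\<mu> j) j k * (shifted_adjacency g x * U k x))"
      unfolding w_def sum_distrib_left by (subst sum.swap) (simp add: mult_ac)
    also have "\<dots> = (\<Sum>k\<in>carrier G. V (\<mu> j) j k * (\<mu> k * U k g))"
      unfolding sum_distrib_left[symmetric] by (intro sum.cong refl) (simp add: eig g)
    also have "\<dots> = (\<Sum>k\<in>carrier G. \<mu> j * (V (\<mu> j) j k * U k g))"
      by (intro sum.cong refl) (metis Vout mult.left_commute mult_zero_left)
    finally show ?thesis by (simp add: w_def sum_distrib_left)
  qed
  have const: "w j g = w j x" if "\<mu> j = top_eigenvalue" "g \<in> carrier G" "x \<in> carrier G" for j g x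
    by (rule top_eigenvector_constant) (use Tw that in auto)
  have zero: "(\<Sum>g\<in>carrier G. w j g) = 0" if "\<mu> j \<noteq> top_eigenvalue" for j
  proof -
    have "(\<Sum>g\<in>carrier G. w j g) = (\<Sum>k\<in>carrier G. V (\<mu> j) j k * (\<Sum>g\<in>carrier G. U k g))"
      unfolding w_def sum_distrib_left by (rule sum.swap)
    also have "\<dots> = 0"
    proof (intro sum.neutral ballI)
      fix k assume "k \<in> carrier G"
      then show "V (\<mu> j) j k * (\<Sum>g\<in>carrier G. U k g) = 0"
        using Vout[of k "\<mu> j" j] eigenspace_sum_zero[OF that, of k]
        by (cases "\<mu> k = \<mu> j") (auto simp: eigenspace_def)
    qed
    finally show ?thesis .
  qed
  \<comment> \<open>Here the shift is removed. It adds the sum of \<open>w j\<close> to every value,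
    which is 0 off the top eigenvalue; a top eigenvector is constant, so the adjacency operator
    multiplies it by \<open>card S\<close>.\<close>
  have eigw: "\<exists>c. \<forall>g\<in>carrier G. (\<Sum>s\<in>S. w j (g \<otimes> s)) = c * w j g" for j
  proof (cases "\<mu> j = top_eigenvalue")
    case True
    have "(\<Sum>s\<in>S. w j (g \<otimes> s)) = (\<Sum>s\<in>S. w j g)" if "g \<in> carrier G" for g
      by (intro sum.cong refl const[OF True]) (use that S_sub in auto)
    then show ?thesis by auto
  next
    case False
    then show ?thesis using Tw[of _ j] shifted_adjacency_apply[of _ "w j"] zero[OF False] by auto
  qed
  have "(\<Sum>g\<in>carrier G. h i g * (w j g)\<^sup>2) = 0 \<or>
      (\<exists>n. min_rep_dim G \<le> n \<and> n \<le> card (carrier G) \<and> n > 0 \<and>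
        \<bar>\<Sum>g\<in>carrier G. h i g * (w j g)\<^sup>2\<bar> \<le>
          sqrt ((\<Sum>g\<in>carrier G. (h i g)\<^sup>2) / real (card (carrier G))) *
          (sqrt (32 / real n) * ln (24 * real M * real n)))"
    if j: "j \<in> carrier G" and i: "i \<in> {1..M}" for i j
  proof (cases "\<mu> j = top_eigenvalue")
    case True
    have "(\<Sum>g\<in>carrier G. h i g * (w j g)\<^sup>2) = (\<Sum>g\<in>carrier G. h i g * (w j \<one>)\<^sup>2)"
      by (intro sum.cong arg_cong2[where f = "(*)"] arg_cong[where f = "\<lambda>x. x\<^sup>2"] refl const[OF True _ one_closed])
    also have "\<dots> = 0" by (simp add: sum_distrib_right[symmetric] mean[OF i])
    finally show ?thesis by simp
  next
    case False
    have jE: "j \<in> eigenspace (\<mu> j)" using j by (simp add: eigenspace_def)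
    have "min_rep_dim G \<le> card (eigenspace (\<mu> j))"
      by (rule min_rep_dim_le_eigenspace[OF False]) (use jE in auto)
    moreover have "card (eigenspace (\<mu> j)) \<le> card (carrier G)"
      by (intro card_mono fin) (auto simp: eigenspace_def)
    moreover have "card (eigenspace (\<mu> j)) > 0"
      using jE finite_eigenspace card_gt_0_iff by blast
    moreover have "(\<Sum>g\<in>carrier G. h i g * (w j g)\<^sup>2) =
        bil (eigenspace (\<mu> j)) (mult_form (h i)) (V (\<mu> j) j) (V (\<mu> j) j)"
      unfolding w_def by (rule quadratic_form_eq[OF V])
    ultimately show ?thesis
      using bound[OF i jE] by auto
  qed
  with w eigw show ?thesis by blast
qed

end

section \<open>Complex-valued functions, centring and the final constants\<close>

text \<open>Orthonormality makes different rows different functions, so sums over the image can be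
  indexed by the group. As \<open>w\<close> is real, a complex function is expanded through its real
  and imaginary parts.\<close>

lemma orthonormal_basis_of_orth:
  assumes fin: "finite (carrier G)" and w: "orth (carrier G) w"
  shows "orthonormal_basis_ell2 G ((\<lambda>j g. complex_of_real (w j g)) ` carrier G)"
proof -
  define \<phi> where "\<phi> j g = complex_of_real (w j g)" for j g
  have inner: "ell2_inner G (\<phi> j) (\<phi> k) = (if j = k then 1 else 0)" if "j \<in> carrier G" "k \<in> carrier G" for j k
  proof -
    have "ell2_inner G (\<phi> j) (\<phi> k) = complex_of_real (\<Sum>g\<in>carrier G. w j g * w k g)"
      by (simp add: ell2_inner_def \<phi>_def)
    then show ?thesis using orth_row[OF w that] by simp
  qed
  have inj: "inj_on \<phi> (carrier G)"
    using inner by (metis inj_onI zero_neq_one)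
  have "\<exists>c. \<forall>g. f g = (\<Sum>\<psi>\<in>\<phi> ` carrier G. c \<psi> * \<psi> g)" if f: "f \<in> ell2 G" for f
  proof (intro exI allI)
    fix g
    have "(\<Sum>\<psi>\<in>\<phi> ` carrier G. ell2_inner G f \<psi> * \<psi> g) = (\<Sum>j\<in>carrier G. ell2_inner G f (\<phi> j) * \<phi> j g)"
      by (simp add: sum.reindex[OF inj])
    also have "\<dots> = f g"
    proof (cases "g \<in> carrier G")
      case True
      have "ell2_inner G f (\<phi> j) = Complex (\<Sum>a\<in>carrier G. w j a * Re (f a)) (\<Sum>a\<in>carrier G. w j a * Im (f a))" for j
        by (rule complex_eqI) (simp_all add: ell2_inner_def \<phi>_def mult.commute)
      then show ?thesis
        using orth_expand[OF fin w True, of "\<lambda>a. Re (f a)"] orth_expand[OF fin w True, of "\<lambda>a. Im (f a)"]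
        by (intro complex_eqI) (simp_all add: \<phi>_def)
    next
      case False
      then show ?thesis using f orth_outside[OF w] by (simp add: ell2_def \<phi>_def)
    qed
    finally show "f g = (\<Sum>\<psi>\<in>\<phi> ` carrier G. ell2_inner G f \<psi> * \<psi> g)" by simp
  qed
  moreover have "\<phi> ` carrier G \<subseteq> ell2 G"
    using orth_outside[OF w] by (auto simp: ell2_def \<phi>_def)
  moreover have "\<forall>\<psi>\<in>\<phi> ` carrier G. \<forall>\<psi>'\<in>\<phi> ` carrier G. ell2_inner G \<psi> \<psi>' = (if \<psi> = \<psi>' then 1 else 0)"
    using inner inj by (auto simp: inj_on_eq_iff)
  ultimately have "orthonormal_basis_ell2 G (\<phi> ` carrier G)"
    using fin by (auto simp: orthonormal_basis_ell2_def)
  then show ?thesis unfolding \<phi>_def .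
qed

text \<open>Centring lowers the sum of squares by the squared mean times
  \<open>card X\<close>.\<close>

lemma sum_square_minus_mean:
  fixes f :: "'a \<Rightarrow> real"
  assumes "finite X" "X \<noteq> {}"
  shows "(\<Sum>g\<in>X. (f g - (\<Sum>x\<in>X. f x) / real (card X))\<^sup>2) \<le> (\<Sum>g\<in>X. (f g)\<^sup>2)"
proof -
  define m where "m = (\<Sum>x\<in>X. f x) / real (card X)"
  have c: "real (card X) > 0" using assms by (simp add: card_gt_0_iff)
  have "(\<Sum>g\<in>X. (f g - m)\<^sup>2) = (\<Sum>g\<in>X. (f g)\<^sup>2) - 2 * m * (\<Sum>g\<in>X. f g) + real (card X) * m\<^sup>2"
    by (simp add: power2_diff sum.distrib sum_subtractf sum_distrib_left sum_distrib_right mult_ac)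
  also have "(\<Sum>g\<in>X. f g) = real (card X) * m" using c by (simp add: m_def)
  also have "(\<Sum>g\<in>X. (f g)\<^sup>2) - 2 * m * (real (card X) * m) + real (card X) * m\<^sup>2 =
      (\<Sum>g\<in>X. (f g)\<^sup>2) - real (card X) * m\<^sup>2" by (simp add: power2_eq_square)
  also have "\<dots> \<le> (\<Sum>g\<in>X. (f g)\<^sup>2)" using c by simp
  finally show ?thesis unfolding m_def .
qed

text \<open>The product \<open>24 * M * n\<close> is at most \<open>N powr (\<epsilon> + 1)\<close>,
  which bounds the logarithm, and \<open>D\<close> below \<open>n\<close> bounds the square root.
  The constant 64 is a generous bound for \<open>sqrt 32\<close>.\<close>

lemma deviation_constant_le:
  fixes \<epsilon> D N n M :: real
  assumes "D > 0" "D \<le> n" "n \<le> N" "M \<ge> 1" "24 * M \<le> N powr \<epsilon>" "n \<ge> 1"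
  shows "sqrt (32 / n) * ln (24 * M * n) \<le> 64 * ((\<epsilon> + 1) * ln N / sqrt D)"
proof -
  have N: "N \<ge> 1" using assms by linarith
  have Mn: "M * n \<ge> 1" using assms by (metis mult_mono mult_1 zero_le_one order_trans)
  have "24 * M * n \<le> N powr \<epsilon> * N"
    using assms N by (intro mult_mono) auto
  also have "\<dots> = N powr (\<epsilon> + 1)" using N by (simp add: powr_add)
  finally have "ln (24 * M * n) \<le> ln (N powr (\<epsilon> + 1))"
    using Mn N by (subst ln_le_cancel_iff) auto
  then have le: "ln (24 * M * n) \<le> (\<epsilon> + 1) * ln N" using N by (simp add: ln_powr)
  have nn: "ln (24 * M * n) \<ge> 0" using Mn by (intro ln_ge_zero) auto
  have "sqrt 32 \<le> sqrt (64\<^sup>2)" by (intro real_sqrt_le_mono) simp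
  then have s32: "sqrt 32 \<le> 64" by simp
  have "sqrt (32 / n) = sqrt 32 / sqrt n" by (rule real_sqrt_divide)
  also have "\<dots> \<le> 64 / sqrt D"
    using assms s32 by (intro frac_le) auto
  finally have "sqrt (32 / n) * ln (24 * M * n) \<le> 64 / sqrt D * ((\<epsilon> + 1) * ln N)"
    using le nn assms by (intro mult_mono) auto
  then show ?thesis by simp
qed

theorem corollary1p3:
  fixes G :: "('a, 'b) monoid_scheme" (structure)
    and S :: "'a set"
    and \<epsilon> :: real
    and M :: nat
    and f :: "nat \<Rightarrow> 'a \<Rightarrow> real"
  assumes "\<epsilon> > 0"
    and "group G" and "finite (carrier G)" and "carrier G \<noteq> {\<one>}"
    and "real (min_rep_dim G) \<ge> (ln (real (card (carrier G))))\<^sup>2"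
    and "S \<subseteq> carrier G" and "(\<lambda>s. inv s) ` S = S"
    and "real M \<le> min (1 / 24 * real (card (carrier G)) powr \<epsilon>)
                       (1 / 8 * inverse (real (card (carrier G))) * exp (real (min_rep_dim G) / 12))"
  shows "\<exists>B. orthonormal_basis_ell2 G B \<and>
           (\<forall>\<phi>\<in>B. cayley_eigenfunction G S \<phi> \<and> (\<forall>g\<in>carrier G. \<phi> g \<in> \<real>)) \<and>
           (\<forall>\<phi>\<in>B. \<forall>i\<in>{1..M}.
              \<bar>eigen_measure G \<phi> (f i) - (\<Sum>g\<in>carrier G. f i g) / real (card (carrier G))\<bar>
              \<le> 64 * ((\<epsilon> + 1) * ln (real (card (carrier G))) / sqrt (real (min_rep_dim G)))
                 * (ell2_norm G (\<lambda>g. complex_of_real (f i g)) / sqrt (real (card (carrier G)))))"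
proof -
  interpret group G by fact
  interpret finite_cayley G S
    by unfold_locales (use assms(3,6,7) in auto)
  define N where "N = real (card (carrier G))"
  define D where "D = real (min_rep_dim G)"
  \<comment> \<open>A nontrivial group has positive \<open>ln N\<close>, so the lower bound on the
    minimal dimension makes \<open>D\<close> positive and \<open>sqrt D\<close> a legitimate
    divisor.\<close>
  have "card (carrier G) \<noteq> 1"
    using assms(4) one_closed by (metis card_1_singletonE singletonD)
  then have N: "N \<ge> 2" using card_pos by (simp add: N_def)
  then have "(ln N)\<^sup>2 > 0" by (simp add: zero_less_power2)
  then have D: "D > 0" using assms(5) unfolding D_def N_def by linarith
  \<comment> \<open>Basis functions have norm 1, so the deviation of the measure of
    \<open>f i\<close> from its mean is the sum of \<open>h i\<close> against the squared basis
    function.\<close>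
  define h where "h i g = f i g - (\<Sum>x\<in>carrier G. f i x) / N" for i g
  have "(\<Sum>g\<in>carrier G. h i g) = 0" for i
    using N by (simp add: h_def sum_subtractf N_def)
  then obtain w where w: "orth (carrier G) w"
    and eig: "\<And>j. j \<in> carrier G \<Longrightarrow> \<exists>c. \<forall>g\<in>carrier G. (\<Sum>s\<in>S. w j (g \<otimes> s)) = c * w j g"
    and dev: "\<And>j i. j \<in> carrier G \<Longrightarrow> i \<in> {1..M} \<Longrightarrow> (\<Sum>g\<in>carrier G. h i g * (w j g)\<^sup>2) = 0 \<or>
      (\<exists>n. min_rep_dim G \<le> n \<and> n \<le> card (carrier G) \<and> n > 0 \<and>
        \<bar>\<Sum>g\<in>carrier G. h i g * (w j g)\<^sup>2\<bar> \<le>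
          sqrt ((\<Sum>g\<in>carrier G. (h i g)\<^sup>2) / real (card (carrier G))) *
          (sqrt (32 / real n) * ln (24 * real M * real n)))"
    using flat_real_eigenbasis[of M h] by blast
  define \<phi> where "\<phi> j g = complex_of_real (w j g)" for j g
  have basis: "orthonormal_basis_ell2 G (\<phi> ` carrier G)"
    unfolding \<phi>_def by (rule orthonormal_basis_of_orth[OF fin w])
  have eigenf: "cayley_eigenfunction G S (\<phi> j)" if j: "j \<in> carrier G" for j
  proof -
    obtain c where c: "\<And>g. g \<in> carrier G \<Longrightarrow> (\<Sum>s\<in>S. w j (g \<otimes> s)) = c * w j g"
      using eig[OF j] by blast
    have "cayley_adjacency G S (\<phi> j) g = complex_of_real c * \<phi> j g" for g
      using c orth_outside[OF w]
      by (auto simp: cayley_adjacency_def \<phi>_def of_real_sum[symmetric] simp del: of_real_sum)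
    moreover have "\<phi> j \<noteq> (\<lambda>_. 0)"
    proof
      assume "\<phi> j = (\<lambda>_. 0)"
      then have "w j g = 0" for g by (simp add: \<phi>_def fun_eq_iff)
      then show False using orth_row[OF w j j] by simp
    qed
    moreover have "\<phi> j \<in> ell2 G" using basis j by (auto simp: orthonormal_basis_ell2_def)
    ultimately show ?thesis by (auto simp: cayley_eigenfunction_def)
  qed
  have bound: "\<bar>eigen_measure G (\<phi> j) (f i) - (\<Sum>g\<in>carrier G. f i g) / N\<bar>
      \<le> 64 * ((\<epsilon> + 1) * ln N / sqrt D) * (ell2_norm G (\<lambda>g. complex_of_real (f i g)) / sqrt N)"
    if j: "j \<in> carrier G" and i: "i \<in> {1..M}" for i j
  proof -
    define m where "m = (\<Sum>g\<in>carrier G. f i g) / N"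
    have "(\<Sum>g\<in>carrier G. h i g * (w j g)\<^sup>2) =
        (\<Sum>g\<in>carrier G. f i g * (w j g)\<^sup>2) - m * (\<Sum>g\<in>carrier G. w j g * w j g)"
      by (simp add: h_def m_def[symmetric] left_diff_distrib sum_subtractf sum_distrib_left power2_eq_square)
    also have "\<dots> = eigen_measure G (\<phi> j) (f i) - m"
      using orth_row[OF w j j] by (simp add: eigen_measure_def \<phi>_def)
    finally have lhs: "eigen_measure G (\<phi> j) (f i) - m = (\<Sum>g\<in>carrier G. h i g * (w j g)\<^sup>2)" by simp
    have norm: "ell2_norm G (\<lambda>g. complex_of_real (f i g)) = sqrt (\<Sum>g\<in>carrier G. (f i g)\<^sup>2)"
      by (simp add: ell2_norm_def ell2_inner_def power2_eq_square)
    have "sqrt ((\<Sum>g\<in>carrier G. (h i g)\<^sup>2) / N) \<le> sqrt ((\<Sum>g\<in>carrier G. (f i g)\<^sup>2) / N)"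
      using sum_square_minus_mean[OF fin, of "f i"] one_closed N
      by (intro real_sqrt_le_mono divide_right_mono) (auto simp: h_def N_def)
    then have \<tau>: "sqrt ((\<Sum>g\<in>carrier G. (h i g)\<^sup>2) / N) \<le> ell2_norm G (\<lambda>g. complex_of_real (f i g)) / sqrt N"
      by (simp add: norm real_sqrt_divide)
    have \<tau>0: "ell2_norm G (\<lambda>g. complex_of_real (f i g)) / sqrt N \<ge> 0"
      using N by (simp add: norm sum_nonneg)
    have K0: "64 * ((\<epsilon> + 1) * ln N / sqrt D) \<ge> 0"
      using assms(1) N D by simp
    from dev[OF j i] show ?thesis
      unfolding m_def[symmetric] lhs
    proof (elim disjE exE conjE)
      assume "(\<Sum>g\<in>carrier G. h i g * (w j g)\<^sup>2) = 0"
      then show "\<bar>\<Sum>g\<in>carrier G. h i g * (w j g)\<^sup>2\<bar> \<le>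
          64 * ((\<epsilon> + 1) * ln N / sqrt D) * (ell2_norm G (\<lambda>g. complex_of_real (f i g)) / sqrt N)"
        using mult_nonneg_nonneg[OF K0 \<tau>0] by simp
    next
      fix n assume n: "min_rep_dim G \<le> n" "n \<le> card (carrier G)" "n > 0"
        and le: "\<bar>\<Sum>g\<in>carrier G. h i g * (w j g)\<^sup>2\<bar> \<le>
          sqrt ((\<Sum>g\<in>carrier G. (h i g)\<^sup>2) / real (card (carrier G))) *
          (sqrt (32 / real n) * ln (24 * real M * real n))"
      have "sqrt (32 / real n) * ln (24 * real M * real n) \<le> 64 * ((\<epsilon> + 1) * ln N / sqrt D)"
        by (rule deviation_constant_le) (use D n i assms(8) in \<open>auto simp: D_def N_def\<close>)
      then have "sqrt ((\<Sum>g\<in>carrier G. (h i g)\<^sup>2) / N) * (sqrt (32 / real n) * ln (24 * real M * real n))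
        \<le> sqrt ((\<Sum>g\<in>carrier G. (h i g)\<^sup>2) / N) * (64 * ((\<epsilon> + 1) * ln N / sqrt D))"
        using N by (intro mult_left_mono) (auto simp: sum_nonneg)
      also have "\<dots> \<le> ell2_norm G (\<lambda>g. complex_of_real (f i g)) / sqrt N * (64 * ((\<epsilon> + 1) * ln N / sqrt D))"
        by (intro mult_right_mono \<tau> K0)
      finally show "\<bar>\<Sum>g\<in>carrier G. h i g * (w j g)\<^sup>2\<bar> \<le>
          64 * ((\<epsilon> + 1) * ln N / sqrt D) * (ell2_norm G (\<lambda>g. complex_of_real (f i g)) / sqrt N)"
        using le by (simp add: N_def mult.commute)
    qed
  qed
  show ?thesis
    using basis eigenf bound unfolding N_def D_def
    by (intro exI[of _ "\<phi> ` carrier G"]) (auto simp: \<phi>_def)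
qed

end
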